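(* For a regular Hausdorff space $X$ the following are equivalent: (1) $X$ is an $\aleph$-space; (2) $\mathcal{F}_2(X)$ has a $\sigma$-HCP $k$-network; (3) $\mathcal{F}(X)$ has a $\sigma$-HCP $k$-network; (4) $\mathcal{F}(X)$ is an $\aleph$-space; (5) $\mathcal{K}(X)$ is an $\aleph$-space.
   Context: $\mathcal{K}(X)$ is the set of nonempty compact subsets of $X$ with the Vietoris topology (base: $\langle U_1,\dots,U_k\rangle=\{K: K\subset\bigcup_i U_i,\ K\cap U_j\neq\emptyset\ \forall j\}$, $U_i$ open in $X$); $\mathcal{F}(X)$ (nonempty finite subsets) and $\mathcal{F}_2(X)$ (nonempty subsets of cardinality at most 2) carry the subspace topology. A family $\mathcal{P}$ is a $k$-network if for every compact $K$ and open $U\supset K$ there is finite $\mathcal{P}'\subset\mathcal{P}$ with $K\subset\bigcup\mathcal{P}'\subset U$. A family $\mathcal{P}$ is hereditarily closure-preserving (HCP) if for any choice $S(P)\subset P$, $P\in\mathcal{P}$, the family $\{S(P)\}$ is closure-preserving (closure of any union of a subfamily equals the union of closures); $\sigma$-HCP means a countable union of HCP families. A space is an $\aleph$-space if it has a $\sigma$-locally finite $k$-network. *)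

theory Defs
  imports "HOL-Analysis.Analysis"
begin

definition vietoris_basic :: "'a topology \<Rightarrow> 'a set set \<Rightarrow> 'a set set" where
  "vietoris_basic X \<U> = {K. compactin X K \<and> K \<noteq> {} \<and> K \<subseteq> \<Union>\<U> \<and> (\<forall>U\<in>\<U>. K \<inter> U \<noteq> {})}"

definition vietoris :: "'a topology \<Rightarrow> 'a set topology" where
  "vietoris X = topology_generated_by
      {vietoris_basic X \<U> | \<U>. finite \<U> \<and> \<U> \<noteq> {} \<and> (\<forall>U\<in>\<U>. openin X U)}"

definition fin_hyperspace :: "'a topology \<Rightarrow> 'a set topology" where
  "fin_hyperspace X = subtopology (vietoris X) {F. finite F \<and> F \<noteq> {} \<and> F \<subseteq> topspace X}"

definition fin2_hyperspace :: "'a topology \<Rightarrow> 'a set topology" where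
  "fin2_hyperspace X = subtopology (vietoris X)
      {F. finite F \<and> F \<noteq> {} \<and> card F \<le> 2 \<and> F \<subseteq> topspace X}"

definition k_network :: "'a topology \<Rightarrow> 'a set set \<Rightarrow> bool" where
  "k_network X \<P> \<longleftrightarrow> (\<forall>P\<in>\<P>. P \<subseteq> topspace X) \<and>
     (\<forall>K U. compactin X K \<and> openin X U \<and> K \<subseteq> U \<longrightarrow>
        (\<exists>\<P>'. \<P>' \<subseteq> \<P> \<and> finite \<P>' \<and> K \<subseteq> \<Union>\<P>' \<and> \<Union>\<P>' \<subseteq> U))"

definition closure_preserving :: "'a topology \<Rightarrow> 'a set set \<Rightarrow> bool" where
  "closure_preserving X \<A> \<longleftrightarrow>
     (\<forall>\<B>. \<B> \<subseteq> \<A> \<longrightarrow> X closure_of (\<Union>\<B>) = \<Union>((\<lambda>B. X closure_of B) ` \<B>))"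

definition hcp :: "'a topology \<Rightarrow> 'a set set \<Rightarrow> bool" where
  "hcp X \<P> \<longleftrightarrow> (\<forall>S. (\<forall>P\<in>\<P>. S P \<subseteq> P) \<longrightarrow> closure_preserving X (S ` \<P>))"

definition sigma_hcp :: "'a topology \<Rightarrow> 'a set set \<Rightarrow> bool" where
  "sigma_hcp X \<P> \<longleftrightarrow> (\<exists>\<P>n :: nat \<Rightarrow> 'a set set. \<P> = (\<Union>n. \<P>n n) \<and> (\<forall>n. hcp X (\<P>n n)))"

definition sigma_locally_finite :: "'a topology \<Rightarrow> 'a set set \<Rightarrow> bool" where
  "sigma_locally_finite X \<P> \<longleftrightarrow>
     (\<exists>\<P>n :: nat \<Rightarrow> 'a set set. \<P> = (\<Union>n. \<P>n n) \<and> (\<forall>n. locally_finite_in X (\<P>n n)))"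

definition aleph_space :: "'a topology \<Rightarrow> bool" where
  "aleph_space X \<longleftrightarrow> (\<exists>\<P>. k_network X \<P> \<and> sigma_locally_finite X \<P>)"

definition has_sigma_hcp_k_network :: "'a topology \<Rightarrow> bool" where
  "has_sigma_hcp_k_network X \<longleftrightarrow> (\<exists>\<P>. k_network X \<P> \<and> sigma_hcp X \<P>)"

end

theory Submission
  imports Defs
begin

text \<open>The only hard step is from a \<open>\<sigma>\<close>-HCP k-network of \<open>\<F>\<^sub>2(X)\<close> to a \<open>\<sigma>\<close>-locally finite
  one of \<open>X\<close>. By regularity the HCP families \<open>\<P>\<^sub>n\<close> may be taken closed and increasing. Each is
  locally finite off the closed set \<open>D\<^sub>n\<close> of points lying in infinitely many members, and every compact
  set meets \<open>D\<^sub>n\<close> in a finite set, so only the behaviour at the points of \<open>D\<^sub>n\<close> has to be repaired.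
  An argument in the spirit of the Siwiec-Nagata theorem writes \<open>D\<^sub>n\<close> as a countable union of sets all
  of whose subsets are closed, and such sets have locally finite expansions that catch compact sets
  near each of their points. Intersecting these with a countable family of sets that suffices to cover
  compact sets near the given point yields the result. The countable family is where the square is
  needed: a k-network at the diagonal point \<open>{x}\<close> of \<open>\<F>\<^sub>2(X)\<close> is countable along the compact set
  \<open>{{z, x} | z \<in> L}\<close> for compact \<open>L\<close>, and its sections at the points of a sequence in \<open>L\<close>
  clustering at \<open>x\<close> do the job.\<close>

section \<open>Hereditarily closure-preserving families\<close>

text \<open>A sigma-HCP k-network of \<open>X\<close> alone is not enough. Glue uncountably many
  convergent sequences at their limits: the tails of the sequences and the isolated points form a
  sigma-HCP k-network, yet no countable family of sets serves the compact sets at the vertex, and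
  the fan is not an aleph-space. The second coordinate of the square excludes this. Along the
  compact set of pairs \<open>{z, x}\<close> with \<open>z \<in> L\<close>, an HCP family has only
  finitely many members with infinite trace, and the finite traces of the others can be dodged by
  moving \<open>z\<close> close to \<open>x\<close>. If no compact set accumulates at
  \<open>x\<close>, there is nothing to cover near \<open>x\<close> but \<open>x\<close> itself. The
  other implications form a cycle from (1) through (5), (4), (3) and (2). Passing to subspaces is
  harmless, since both kinds of families pull back; only the step from (1) to (5) needs a
  construction. It works because the union of a compact family of compact sets is compact, so that a
  finite part of the k-network of \<open>X\<close> can serve the whole family.\<close>

text \<open>Choosing the empty set in the members to be dropped turns any subfamily into the full
  family, so one inclusion per choice suffices. The indexed unions also spare the bookkeeping for
  members on which \<open>S\<close> takes equal values.\<close>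

lemma hcp_iff:
  "hcp X \<P> \<longleftrightarrow> (\<forall>S. (\<forall>P\<in>\<P>. S P \<subseteq> P) \<longrightarrow>
     X closure_of (\<Union>P\<in>\<P>. S P) \<subseteq> (\<Union>P\<in>\<P>. X closure_of (S P)))"
proof
  assume L: "hcp X \<P>"
  show "\<forall>S. (\<forall>P\<in>\<P>. S P \<subseteq> P) \<longrightarrow> X closure_of (\<Union>P\<in>\<P>. S P) \<subseteq> (\<Union>P\<in>\<P>. X closure_of (S P))"
  proof (intro allI impI)
    fix S assume "\<forall>P\<in>\<P>. S P \<subseteq> P"
    then have "closure_preserving X (S ` \<P>)" using L by (simp add: hcp_def)
    then have "X closure_of (\<Union>(S ` \<P>)) = \<Union>((\<lambda>B. X closure_of B) ` S ` \<P>)"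
      unfolding closure_preserving_def by blast
    then show "X closure_of (\<Union>P\<in>\<P>. S P) \<subseteq> (\<Union>P\<in>\<P>. X closure_of (S P))" by auto
  qed
next
  assume R: "\<forall>S. (\<forall>P\<in>\<P>. S P \<subseteq> P) \<longrightarrow> X closure_of (\<Union>P\<in>\<P>. S P) \<subseteq> (\<Union>P\<in>\<P>. X closure_of (S P))"
  show "hcp X \<P>"
    unfolding hcp_def closure_preserving_def
  proof (intro allI impI)
    fix S \<B> assume S: "\<forall>P\<in>\<P>. S P \<subseteq> P" and B: "\<B> \<subseteq> S ` \<P>"
    define T where "T P = (if S P \<in> \<B> then S P else {})" for P
    have "\<forall>P\<in>\<P>. T P \<subseteq> P" using S by (auto simp: T_def)
    then have *: "X closure_of (\<Union>P\<in>\<P>. T P) \<subseteq> (\<Union>P\<in>\<P>. X closure_of (T P))" using R by blast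
    have "(\<Union>P\<in>\<P>. T P) = \<Union>\<B>" using B by (auto simp: T_def split: if_splits)
    moreover have "(\<Union>P\<in>\<P>. X closure_of (T P)) \<subseteq> (\<Union>B\<in>\<B>. X closure_of B)"
      by (auto simp: T_def split: if_splits)
    ultimately show "X closure_of (\<Union>\<B>) = \<Union>((\<lambda>B. X closure_of B) ` \<B>)"
      using * closure_of_Union_subset[of X \<B>] by auto
  qed
qed

lemma hcp_closure_of_UN:
  assumes "hcp X \<P>" "\<And>P. P \<in> \<P> \<Longrightarrow> S P \<subseteq> P"
  shows "X closure_of (\<Union>P\<in>\<P>. S P) = (\<Union>P\<in>\<P>. X closure_of (S P))"
proof
  show "X closure_of (\<Union>P\<in>\<P>. S P) \<subseteq> (\<Union>P\<in>\<P>. X closure_of (S P))"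
    using assms unfolding hcp_iff by blast
  show "(\<Union>P\<in>\<P>. X closure_of (S P)) \<subseteq> X closure_of (\<Union>P\<in>\<P>. S P)"
    by (simp add: SUP_le_iff SUP_upper closure_of_mono)
qed

lemma hcp_closedin_UN:
  assumes "hcp X \<P>" "\<And>P. P \<in> \<P> \<Longrightarrow> S P \<subseteq> P" "\<And>P. P \<in> \<P> \<Longrightarrow> closedin X (S P)"
  shows "closedin X (\<Union>P\<in>\<P>. S P)"
proof -
  have "X closure_of (\<Union>P\<in>\<P>. S P) = (\<Union>P\<in>\<P>. S P)"
    using hcp_closure_of_UN[of X \<P> S] assms by (simp add: closure_of_closedin)
  then show ?thesis by (metis closedin_closure_of)
qed

lemma hcp_closedin_Union:
  assumes "hcp X \<P>" "\<And>P. P \<in> \<P> \<Longrightarrow> closedin X P" "\<Q> \<subseteq> \<P>"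
  shows "closedin X (\<Union>\<Q>)"
proof -
  have "closedin X (\<Union>P\<in>\<P>. if P \<in> \<Q> then P else {})"
    by (rule hcp_closedin_UN[OF assms(1)]) (use assms in auto)
  moreover have "(\<Union>P\<in>\<P>. if P \<in> \<Q> then P else {}) = \<Union>\<Q>"
    using assms(3) by (auto split: if_splits)
  ultimately show ?thesis by simp
qed

lemma hcp_Un:
  assumes "hcp X \<P>" "hcp X \<Q>" shows "hcp X (\<P> \<union> \<Q>)"
  unfolding hcp_iff
proof (intro allI impI)
  fix S assume S: "\<forall>P\<in>\<P> \<union> \<Q>. S P \<subseteq> P"
  have "X closure_of (\<Union>P\<in>\<P>. S P) = (\<Union>P\<in>\<P>. X closure_of (S P))"
    by (rule hcp_closure_of_UN[OF assms(1)]) (use S in blast)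
  moreover have "X closure_of (\<Union>P\<in>\<Q>. S P) = (\<Union>P\<in>\<Q>. X closure_of (S P))"
    by (rule hcp_closure_of_UN[OF assms(2)]) (use S in blast)
  ultimately show "X closure_of (\<Union>P\<in>\<P> \<union> \<Q>. S P) \<subseteq> (\<Union>P\<in>\<P> \<union> \<Q>. X closure_of (S P))"
    by (simp add: UN_Un)
qed

lemma hcp_finite_UN:
  assumes "finite I" "\<And>i. i \<in> I \<Longrightarrow> hcp X (\<P> i)" shows "hcp X (\<Union>i\<in>I. \<P> i)"
  using assms
proof (induction I rule: finite_induct)
  case empty then show ?case by (simp add: hcp_iff)
next
  case (insert i I) then show ?case by (simp add: hcp_Un)
qed

text \<open>If \<open>x\<close> lies outside the closures of all the \<open>S P \<subseteq> cl P\<close>, regularity separates \<open>x\<close> from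
  \<open>S P\<close> by a closed neighbourhood \<open>cl (V P)\<close>, and \<open>P - cl (V P)\<close> is a subset of \<open>P\<close> itself whose
  closure still covers \<open>S P\<close>.\<close>
lemma hcp_closure:
  assumes "regular_space X" "hcp X \<P>" "\<And>P. P \<in> \<P> \<Longrightarrow> P \<subseteq> topspace X"
  shows "hcp X ((\<lambda>P. X closure_of P) ` \<P>)"
  unfolding hcp_iff
proof (intro allI impI subsetI)
  fix S x
  assume S: "\<forall>P\<in>(\<lambda>P. X closure_of P) ` \<P>. S P \<subseteq> P"
    and x: "x \<in> X closure_of (\<Union>P\<in>(\<lambda>P. X closure_of P) ` \<P>. S P)"
  show "x \<in> (\<Union>P\<in>(\<lambda>P. X closure_of P) ` \<P>. X closure_of (S P))"
  proof (rule ccontr)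
    assume n: "\<not> ?thesis"
    have xX: "x \<in> topspace X" using x by (meson in_closure_of)
    have "\<exists>V. openin X V \<and> x \<in> V \<and> disjnt (S (X closure_of P)) (X closure_of V)" if "P \<in> \<P>" for P
    proof -
      have "closedin X (X closure_of (S (X closure_of P)))" "x \<in> topspace X - X closure_of (S (X closure_of P))"
        using n that xX by auto
      then obtain V where V: "openin X V" "x \<in> V" "disjnt (X closure_of (S (X closure_of P))) (X closure_of V)"
        using assms(1) unfolding regular_space by blast
      moreover have "S (X closure_of P) \<subseteq> X closure_of (S (X closure_of P))"
        using S that closure_of_subset_topspace[of X P] by (intro closure_of_subset) blast
      ultimately show ?thesis by (meson disjnt_subset1)
    qed
    then obtain V where V: "\<And>P. P \<in> \<P> \<Longrightarrow> openin X (V P) \<and> x \<in> V P \<and> disjnt (S (X closure_of P)) (X closure_of (V P))"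
      by metis
    define T where "T P = P - X closure_of (V P)" for P
    have ST: "S (X closure_of P) \<subseteq> X closure_of (T P)" if P: "P \<in> \<P>" for P
    proof -
      have "openin X (topspace X - X closure_of (V P))" by (intro openin_diff openin_topspace closedin_closure_of)
      then have "(topspace X - X closure_of (V P)) \<inter> X closure_of P
          \<subseteq> X closure_of ((topspace X - X closure_of (V P)) \<inter> P)"
        by (rule openin_Int_closure_of_subset)
      moreover have "(topspace X - X closure_of (V P)) \<inter> P = T P"
        using assms(3) P by (auto simp: T_def)
      moreover have "S (X closure_of P) \<subseteq> (topspace X - X closure_of (V P)) \<inter> X closure_of P"
        using V[OF P] S P closure_of_subset_topspace[of X P] unfolding disjnt_iff by blast
      ultimately show ?thesis by auto
    qed
    then have "(\<Union>P\<in>\<P>. S (X closure_of P)) \<subseteq> (\<Union>P\<in>\<P>. X closure_of (T P))"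
      by (rule UN_mono[OF order_refl])
    then have "(\<Union>P\<in>(\<lambda>P. X closure_of P) ` \<P>. S P) \<subseteq> (\<Union>P\<in>\<P>. X closure_of (T P))" by simp
    also have "\<dots> = X closure_of (\<Union>P\<in>\<P>. T P)"
      using hcp_closure_of_UN[OF assms(2), of T] by (auto simp: T_def)
    finally have "x \<in> X closure_of (\<Union>P\<in>\<P>. T P)"
      using x by (meson closedin_closure_of closure_of_minimal subsetD)
    then have "x \<in> (\<Union>P\<in>\<P>. X closure_of (T P))"
      using hcp_closure_of_UN[OF assms(2), of T] by (auto simp: T_def)
    then obtain P where P: "P \<in> \<P>" "x \<in> X closure_of (T P)" by blast
    have "V P \<inter> T P = {}"
      using closure_of_subset[of "V P" X] V[OF P(1)] openin_subset unfolding T_def by blast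
    then show False using P V[OF P(1)] by (meson disjoint_iff in_closure_of)
  qed
qed

lemma locally_finite_imp_hcp:
  assumes "locally_finite_in X \<P>" shows "hcp X \<P>"
  unfolding hcp_def closure_preserving_def
proof (intro allI impI)
  fix S \<B> assume S: "\<forall>P\<in>\<P>. S P \<subseteq> P" and B: "\<B> \<subseteq> S ` \<P>"
  have "locally_finite_in X (S ` \<P>)"
    by (rule locally_finite_in_refinement[OF assms]) (use S in blast)
  then have "locally_finite_in X \<B>" using B by (rule locally_finite_in_subset)
  then show "X closure_of (\<Union>\<B>) = \<Union>((\<lambda>B. X closure_of B) ` \<B>)"
    by (rule closure_of_locally_finite_Union)
qed

lemma aleph_imp_sigma_hcp:
  "aleph_space X \<Longrightarrow> has_sigma_hcp_k_network X"
  unfolding aleph_space_def has_sigma_hcp_k_network_def sigma_hcp_def sigma_locally_finite_def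
  by (blast intro: locally_finite_imp_hcp)

section \<open>Pulling back along initial maps\<close>

text \<open>\<open>X\<close> carries the topology induced by \<open>f\<close>. One notion covers the
  inclusions between hyperspaces and the map sending \<open>x\<close> to \<open>{x}\<close>.\<close>

definition initial_map :: "'a topology \<Rightarrow> 'b topology \<Rightarrow> ('a \<Rightarrow> 'b) \<Rightarrow> bool" where
  "initial_map X Y f \<longleftrightarrow> continuous_map X Y f \<and>
     (\<forall>U. openin X U \<longrightarrow> (\<exists>V. openin Y V \<and> U = {x \<in> topspace X. f x \<in> V}))"

lemma initial_map_subtopology: "initial_map (subtopology X S) X id"
  by (auto simp: initial_map_def openin_subtopology dest: openin_subset)

lemma k_network_vimage:
  assumes "initial_map X Y f" "k_network Y \<P>"
  shows "k_network X ((\<lambda>P. {x \<in> topspace X. f x \<in> P}) ` \<P>)"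
  unfolding k_network_def
proof (intro conjI allI impI)
  fix K U assume KU: "compactin X K \<and> openin X U \<and> K \<subseteq> U"
  obtain V where V: "openin Y V" "U = {x \<in> topspace X. f x \<in> V}"
    using assms(1) KU unfolding initial_map_def by blast
  have "compactin Y (f ` K)"
    using assms(1) KU image_compactin unfolding initial_map_def by blast
  moreover have "f ` K \<subseteq> V" using KU V by blast
  ultimately obtain \<P>' where P': "\<P>' \<subseteq> \<P>" "finite \<P>'" "f ` K \<subseteq> \<Union>\<P>'" "\<Union>\<P>' \<subseteq> V"
    using assms(2) V unfolding k_network_def by meson
  let ?\<Q> = "(\<lambda>P. {x \<in> topspace X. f x \<in> P}) ` \<P>'"
  have "K \<subseteq> topspace X" using KU compactin_subset_topspace by blast
  then have "K \<subseteq> \<Union>?\<Q>" using P'(3) by blast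
  moreover have "\<Union>?\<Q> \<subseteq> U" using P'(4) V(2) by blast
  ultimately show "\<exists>\<P>'\<subseteq>(\<lambda>P. {x \<in> topspace X. f x \<in> P}) ` \<P>. finite \<P>' \<and> K \<subseteq> \<Union>\<P>' \<and> \<Union>\<P>' \<subseteq> U"
    using P'(1,2) by (meson finite_imageI image_mono)
qed auto

text \<open>Continuity pushes a closure point forward, HCP in \<open>Y\<close> selects a single
  member whose chosen part clusters at the image, and initiality pulls this back, every
  neighbourhood of \<open>x\<close> being a preimage.\<close>

lemma hcp_vimage:
  assumes f: "initial_map X Y f" and "hcp Y \<P>"
  shows "hcp X ((\<lambda>P. {x \<in> topspace X. f x \<in> P}) ` \<P>)"
  unfolding hcp_iff
proof (intro allI impI subsetI)
  let ?g = "\<lambda>P. {x \<in> topspace X. f x \<in> P}"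
  fix S x
  assume S: "\<forall>P\<in>?g ` \<P>. S P \<subseteq> P" and x: "x \<in> X closure_of (\<Union>P\<in>?g ` \<P>. S P)"
  have "f x \<in> Y closure_of (f ` (\<Union>P\<in>?g ` \<P>. S P))"
    using continuous_map_image_closure_subset[of X Y f] f x unfolding initial_map_def by fast
  also have "f ` (\<Union>P\<in>?g ` \<P>. S P) = (\<Union>P\<in>\<P>. f ` S (?g P))" by auto
  also have "Y closure_of \<dots> = (\<Union>P\<in>\<P>. Y closure_of (f ` S (?g P)))"
    by (rule hcp_closure_of_UN[OF assms(2)]) (use S in blast)
  finally obtain P where P: "P \<in> \<P>" "f x \<in> Y closure_of (f ` S (?g P))" by blast
  have "x \<in> X closure_of (S (?g P))"
    unfolding in_closure_of
  proof (intro conjI allI impI)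
    show "x \<in> topspace X" using x by (meson in_closure_of)
    fix U assume U: "x \<in> U \<and> openin X U"
    then obtain V where V: "openin Y V" "U = {x \<in> topspace X. f x \<in> V}"
      using f unfolding initial_map_def by blast
    then obtain z where "z \<in> S (?g P)" "f z \<in> V" using P(2) U by (auto simp: in_closure_of)
    then show "\<exists>y. y \<in> S (?g P) \<and> y \<in> U" using V P(1) S by blast
  qed
  then show "x \<in> (\<Union>P\<in>?g ` \<P>. X closure_of (S P))" using P(1) by blast
qed

lemma locally_finite_vimage:
  assumes f: "initial_map X Y f" and P: "locally_finite_in Y \<P>"
  shows "locally_finite_in X ((\<lambda>P. {x \<in> topspace X. f x \<in> P}) ` \<P>)"
  unfolding locally_finite_in_def
proof (intro conjI ballI)
  let ?g = "\<lambda>P. {x \<in> topspace X. f x \<in> P}"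
  fix x assume x: "x \<in> topspace X"
  have c: "continuous_map X Y f" using f by (simp add: initial_map_def)
  then have "f x \<in> topspace Y" using x continuous_map_image_subset_topspace by blast
  then obtain V where V: "openin Y V" "f x \<in> V" "finite {U \<in> \<P>. U \<inter> V \<noteq> {}}"
    using P unfolding locally_finite_in_def by blast
  have "{U \<in> ?g ` \<P>. U \<inter> ?g V \<noteq> {}} \<subseteq> ?g ` {U \<in> \<P>. U \<inter> V \<noteq> {}}" by blast
  then have "finite {U \<in> ?g ` \<P>. U \<inter> ?g V \<noteq> {}}" using V(3) finite_surj by blast
  moreover have "openin X (?g V)" using c V(1) by (rule openin_continuous_map_preimage)
  ultimately show "\<exists>W. openin X W \<and> x \<in> W \<and> finite {U \<in> ?g ` \<P>. U \<inter> W \<noteq> {}}"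
    using x V(2) by (intro exI[of _ "?g V"]) auto
qed blast

lemma has_sigma_hcp_k_network_vimage:
  assumes "initial_map X Y f" "has_sigma_hcp_k_network Y"
  shows "has_sigma_hcp_k_network X"
proof -
  let ?g = "\<lambda>P. {x \<in> topspace X. f x \<in> P}"
  obtain \<P> where P: "k_network Y (\<Union>n::nat. \<P> n)" "\<And>n. hcp Y (\<P> n)"
    using assms(2) unfolding has_sigma_hcp_k_network_def sigma_hcp_def by blast
  have "k_network X (?g ` (\<Union>n. \<P> n))" using k_network_vimage[OF assms(1) P(1)] .
  moreover have "sigma_hcp X (?g ` (\<Union>n. \<P> n))"
    unfolding sigma_hcp_def
    by (intro exI[of _ "\<lambda>n. ?g ` \<P> n"] conjI allI hcp_vimage[OF assms(1)] P(2) image_UN)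
  ultimately show ?thesis unfolding has_sigma_hcp_k_network_def by blast
qed

lemma aleph_space_vimage:
  assumes "initial_map X Y f" "aleph_space Y"
  shows "aleph_space X"
proof -
  let ?g = "\<lambda>P. {x \<in> topspace X. f x \<in> P}"
  obtain \<P> where P: "k_network Y (\<Union>n::nat. \<P> n)" "\<And>n. locally_finite_in Y (\<P> n)"
    using assms(2) unfolding aleph_space_def sigma_locally_finite_def by blast
  have "k_network X (?g ` (\<Union>n. \<P> n))" using k_network_vimage[OF assms(1) P(1)] .
  moreover have "sigma_locally_finite X (?g ` (\<Union>n. \<P> n))"
    unfolding sigma_locally_finite_def
    by (intro exI[of _ "\<lambda>n. ?g ` \<P> n"] conjI allI locally_finite_vimage[OF assms(1)] P(2) image_UN)
  ultimately show ?thesis unfolding aleph_space_def by blast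
qed

section \<open>Points at which a family is infinite\<close>

definition inf_points :: "'a topology \<Rightarrow> 'a set set \<Rightarrow> 'a set" where
  "inf_points X \<P> = {x \<in> topspace X. infinite {P \<in> \<P>. x \<in> P}}"

text \<open>Greedy choice of distinct representatives; it supplies different members through the
  different points of a sequence in \<open>inf_points\<close>.\<close>

lemma infinite_injective_choice:
  fixes A :: "nat \<Rightarrow> 'b set"
  assumes "\<And>n. infinite (A n)"
  obtains f where "inj f" "\<And>n. f n \<in> A n"
proof -
  have "\<exists>f. \<forall>n. f n \<in> A n - f ` {..<n}"
  proof (rule dependent_wellorder_choice)
    show "\<exists>r. r \<in> A n - f ` {..<n}" for n and f :: "nat \<Rightarrow> 'b"
    proof -
      have "infinite (A n - f ` {..<n})" using assms by (intro Diff_infinite_finite) auto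
      then show ?thesis using infinite_imp_nonempty by blast
    qed
  next
    fix r :: 'b and f g :: "nat \<Rightarrow> 'b" and n
    assume "\<And>y. y < n \<Longrightarrow> f y = g y"
    then have "f ` {..<n} = g ` {..<n}" by simp
    then show "(r \<in> A n - f ` {..<n}) = (r \<in> A n - g ` {..<n})" by simp
  qed
  then obtain f where f: "\<And>n. f n \<in> A n" "\<And>n. f n \<notin> f ` {..<n}" by blast
  have "f m \<noteq> f n" if "m < n" for m n using f(2)[of n] that by (metis imageI lessThan_iff)
  then have "inj f" by (intro linorder_injI) blast
  then show thesis using f(1) that by blast
qed

text \<open>An infinite \<open>A\<close> would have an accumulation point \<open>x\<close>; it is
  still one of \<open>A - {x}\<close>, which is closed and misses it.\<close>

lemma hereditarily_closed_compact_finite: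
  assumes K: "compactin X K" and A: "A \<subseteq> K" "\<And>B. B \<subseteq> A \<Longrightarrow> closedin X B"
  shows "finite A"
proof (rule ccontr)
  assume "infinite A"
  then obtain x where x: "x \<in> X derived_set_of A"
    using compactin_imp_Bolzano_Weierstrass[OF K, of A] A(1) by (metis disjoint_iff)
  have "closedin X (A - {x})" by (rule A(2)) blast
  then have "X derived_set_of (A - {x}) \<subseteq> A - {x}" by (simp add: closedin_contains_derived_set)
  moreover have "x \<in> X derived_set_of (A - {x})"
    using x by (auto simp: in_derived_set_of)
  ultimately show False by blast
qed

text \<open>Shrinking each member \<open>f a\<close> to \<open>{a}\<close> and all other members to
  the empty set is an admissible choice, so HCP makes every subset of \<open>A\<close> closed. The
  finiteness statements below all come down to this.\<close>

lemma hcp_compact_injective_finite: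
  assumes t1: "t1_space X" and hcp: "hcp X \<P>" and K: "compactin X K" and A: "A \<subseteq> K"
    and f: "inj_on f A" "\<And>a. a \<in> A \<Longrightarrow> f a \<in> \<P>" "\<And>a. a \<in> A \<Longrightarrow> a \<in> f a"
  shows "finite A"
proof (rule hereditarily_closed_compact_finite[OF K A])
  fix B assume B: "B \<subseteq> A"
  define S where "S P = {a \<in> B. f a = P}" for P
  have cl: "closedin X (S P)" for P
  proof -
    have "S P = {} \<or> (\<exists>a\<in>B. S P = {a})"
      using f(1) B unfolding S_def inj_on_def by blast
    then show ?thesis
      using closedin_t1_singleton[OF t1] A B compactin_subset_topspace[OF K] by (metis closedin_empty subsetD)
  qed
  have "closedin X (\<Union>P\<in>\<P>. S P)"
    by (rule hcp_closedin_UN[OF hcp _ cl]) (use f(3) B in \<open>auto simp: S_def\<close>)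
  moreover have "(\<Union>P\<in>\<P>. S P) = B" using f(2) B by (auto simp: S_def)
  ultimately show "closedin X B" by simp
qed

text \<open>Infinitely many such points in \<open>K\<close> would allow an injective assignment of
  members to points, as each point has infinitely many members to offer.\<close>

lemma finite_compact_Int_inf_points:
  assumes "t1_space X" "hcp X \<P>" "compactin X K"
  shows "finite (K \<inter> inf_points X \<P>)"
proof (rule ccontr)
  assume "infinite (K \<inter> inf_points X \<P>)"
  then obtain x :: "nat \<Rightarrow> 'a" where x: "inj x" "range x \<subseteq> K \<inter> inf_points X \<P>"
    using infinite_countable_subset by blast
  have inf: "infinite {P \<in> \<P>. x n \<in> P}" for n using x(2) by (auto simp: inf_points_def)
  obtain f where f: "inj f" "\<And>n. f n \<in> {P \<in> \<P>. x n \<in> P}"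
    by (rule infinite_injective_choice[of "\<lambda>n. {P \<in> \<P>. x n \<in> P}", OF inf]) (rule that)
  have "finite (range x)"
  proof (rule hcp_compact_injective_finite[OF assms, of _ "f \<circ> inv x"])
    show "inj_on (f \<circ> inv x) (range x)" using f(1) x(1) by (auto simp: inj_on_def)
    show "range x \<subseteq> K" using x(2) by blast
    fix a assume "a \<in> range x"
    then obtain n where "a = x n" by blast
    then show "(f \<circ> inv x) a \<in> \<P>" "a \<in> (f \<circ> inv x) a" using f(2)[of n] x(1) by auto
  qed
  then show False using x(1) by (simp add: finite_image_iff)
qed

text \<open>Pick in each such member a point of \<open>K\<close> off \<open>inf_points\<close>. The
  points picked are injectively assigned to members by a right inverse, hence finite in number, and
  each lies in only finitely many members.\<close>

lemma finite_meeting_compact_Diff_inf_points: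
  assumes "t1_space X" "hcp X \<P>" "compactin X K"
  shows "finite {P \<in> \<P>. P \<inter> K - inf_points X \<P> \<noteq> {}}" (is "finite ?Q")
proof -
  have "\<forall>P\<in>?Q. \<exists>x. x \<in> P \<inter> K - inf_points X \<P>" by blast
  then obtain x where "\<forall>P\<in>?Q. x P \<in> P \<inter> K - inf_points X \<P>" by (rule bchoice[THEN exE])
  then have x: "\<And>P. P \<in> ?Q \<Longrightarrow> x P \<in> P \<inter> K - inf_points X \<P>" by (rule bspec)
  have "finite (x ` ?Q)"
  proof (rule hcp_compact_injective_finite[OF assms, of _ "inv_into ?Q x"])
    show "inj_on (inv_into ?Q x) (x ` ?Q)" by (simp add: inj_on_inv_into)
    show "x ` ?Q \<subseteq> K" using x by blast
    fix a assume a: "a \<in> x ` ?Q"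
    then have *: "inv_into ?Q x a \<in> ?Q" by (rule inv_into_into)
    then show "inv_into ?Q x a \<in> \<P>" by blast
    show "a \<in> inv_into ?Q x a" using x[OF *] f_inv_into_f[OF a] by simp
  qed
  moreover have "finite {P \<in> \<P>. a \<in> P}" if "a \<in> x ` ?Q" for a
  proof -
    have "a \<in> K" "a \<notin> inf_points X \<P>" using x that by blast+
    then show ?thesis using compactin_subset_topspace[OF assms(3)] by (auto simp: inf_points_def)
  qed
  ultimately have "finite (\<Union>a\<in>x ` ?Q. {P \<in> \<P>. a \<in> P})" by blast
  moreover have "?Q \<subseteq> (\<Union>a\<in>x ` ?Q. {P \<in> \<P>. a \<in> P})" using x by blast
  ultimately show ?thesis by (rule rev_finite_subset)
qed

text \<open>An infinite trace cannot fit into the finite set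
  \<open>K \<inter> inf_points X \<P>\<close>, so the preceding bound applies. This is the source of
  countability in the symmetric square.\<close>

lemma finite_infinite_trace:
  assumes "t1_space X" "hcp X \<P>" "compactin X K"
  shows "finite {P \<in> \<P>. infinite (P \<inter> K)}"
proof (rule finite_subset[OF _ finite_meeting_compact_Diff_inf_points[OF assms]], clarify)
  fix P assume "P \<in> \<P>" "infinite (P \<inter> K)" "P \<inter> K - inf_points X \<P> = {}"
  then have "P \<inter> K \<subseteq> K \<inter> inf_points X \<P>" by blast
  then show False using finite_compact_Int_inf_points[OF assms] \<open>infinite (P \<inter> K)\<close> finite_subset by blast
qed

text \<open>The largest set of points all of whose members also contain \<open>x\<close>. For closed
  HCP families it is an open neighbourhood of \<open>x\<close>, and takes the place of a
  neighbourhood meeting few members.\<close>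

definition hcp_nhd :: "'a topology \<Rightarrow> 'a set set \<Rightarrow> 'a \<Rightarrow> 'a set" where
  "hcp_nhd X \<P> x = topspace X - \<Union>{P \<in> \<P>. x \<notin> P}"

lemma openin_hcp_nhd:
  assumes "hcp X \<P>" "\<And>P. P \<in> \<P> \<Longrightarrow> closedin X P"
  shows "openin X (hcp_nhd X \<P> x)"
  unfolding hcp_nhd_def
  by (intro openin_diff openin_topspace hcp_closedin_Union[OF assms]) auto

lemma mem_hcp_nhd: "y \<in> hcp_nhd X \<P> x \<longleftrightarrow> y \<in> topspace X \<and> (\<forall>P\<in>\<P>. y \<in> P \<longrightarrow> x \<in> P)"
  by (auto simp: hcp_nhd_def)

text \<open>A point of \<open>hcp_nhd X \<P> x\<close> lies only in members through
  \<open>x\<close>, so finiteness of their number spreads from \<open>x\<close> to a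
  neighbourhood.\<close>

lemma closedin_inf_points:
  assumes "hcp X \<P>" "\<And>P. P \<in> \<P> \<Longrightarrow> closedin X P"
  shows "closedin X (inf_points X \<P>)"
proof -
  have "openin X (topspace X - inf_points X \<P>)"
  proof (subst openin_subopen, intro ballI exI conjI)
    fix x assume x: "x \<in> topspace X - inf_points X \<P>"
    show "openin X (hcp_nhd X \<P> x)" by (rule openin_hcp_nhd[OF assms])
    show "x \<in> hcp_nhd X \<P> x" using x by (simp add: mem_hcp_nhd)
    show "hcp_nhd X \<P> x \<subseteq> topspace X - inf_points X \<P>"
    proof
      fix y assume y: "y \<in> hcp_nhd X \<P> x"
      then have "{P \<in> \<P>. y \<in> P} \<subseteq> {P \<in> \<P>. x \<in> P}" by (auto simp: mem_hcp_nhd)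
      then have "finite {P \<in> \<P>. y \<in> P}" using x finite_subset by (auto simp: inf_points_def)
      then show "y \<in> topspace X - inf_points X \<P>" using y by (auto simp: inf_points_def mem_hcp_nhd)
    qed
  qed
  moreover have "inf_points X \<P> \<subseteq> topspace X" by (auto simp: inf_points_def)
  ultimately show ?thesis by (simp add: closedin_def)
qed

text \<open>At points of \<open>F\<close> the members meeting \<open>hcp_nhd\<close> all pass
  through \<open>x\<close>. Cutting with a closed \<open>F\<close> extends local finiteness to all
  of \<open>X\<close>: the points of \<open>inf_points\<close> have the complement of
  \<open>F\<close> as a neighbourhood.\<close>

lemma locally_finite_off_inf_points:
  assumes "hcp X \<P>" "\<And>P. P \<in> \<P> \<Longrightarrow> closedin X P" "closedin X F" "F \<inter> inf_points X \<P> = {}"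
    and "x \<in> topspace X"
  shows "\<exists>V. openin X V \<and> x \<in> V \<and> finite {P \<in> \<P>. P \<inter> F \<inter> V \<noteq> {}}"
proof (cases "x \<in> F")
  case True
  have "{P \<in> \<P>. P \<inter> F \<inter> hcp_nhd X \<P> x \<noteq> {}} \<subseteq> {P \<in> \<P>. x \<in> P}" by (auto simp: mem_hcp_nhd)
  moreover have "finite {P \<in> \<P>. x \<in> P}" using True assms by (auto simp: inf_points_def)
  ultimately have "finite {P \<in> \<P>. P \<inter> F \<inter> hcp_nhd X \<P> x \<noteq> {}}" by (rule finite_subset)
  moreover have "openin X (hcp_nhd X \<P> x)" by (rule openin_hcp_nhd[OF assms(1,2)])
  ultimately show ?thesis using assms(5) by (intro exI[of _ "hcp_nhd X \<P> x"]) (simp add: mem_hcp_nhd)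
next
  case False
  have "{P \<in> \<P>. P \<inter> F \<inter> (topspace X - F) \<noteq> {}} = {}" by blast
  then have "finite {P \<in> \<P>. P \<inter> F \<inter> (topspace X - F) \<noteq> {}}" by (metis finite.emptyI)
  then show ?thesis using False assms(3,5) by (intro exI[of _ "topspace X - F"]) auto
qed

section \<open>Regular spaces with a closed hereditarily closure-preserving k-network\<close>

lemma regular_space_nhd:
  assumes "regular_space X" "openin X U" "x \<in> U"
  obtains W where "openin X W" "x \<in> W" "X closure_of W \<subseteq> U"
proof -
  have "closedin X (topspace X - U)" using assms(2) by (intro closedin_diff closedin_topspace)
  moreover have "x \<in> topspace X - (topspace X - U)" using assms(2,3) openin_subset by fast
  ultimately obtain W where "openin X W" "x \<in> W" "disjnt (topspace X - U) (X closure_of W)"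
    using assms(1) unfolding regular_space by meson
  then show thesis using that closure_of_subset_topspace[of X W] by (auto simp: disjnt_iff)
qed

lemma regular_space_compact_nhd:
  assumes "regular_space X" "compactin X K" "openin X U" "K \<subseteq> U"
  obtains W where "openin X W" "K \<subseteq> W" "X closure_of W \<subseteq> U"
proof -
  have "closedin X (topspace X - U)" using assms(3) by (intro closedin_diff closedin_topspace)
  moreover have "disjnt K (topspace X - U)" using assms(4) by (auto simp: disjnt_iff)
  ultimately obtain W V where W: "openin X W" "openin X V" "K \<subseteq> W" "topspace X - U \<subseteq> V" "disjnt W V"
    using regular_space_compact_closed_separation[OF assms(1,2)] by meson
  have "closedin X (topspace X - V)" using W(2) by (intro closedin_diff closedin_topspace)
  moreover have "W \<subseteq> topspace X - V" using W(1,5) openin_subset by (fastforce simp: disjnt_iff)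
  ultimately have "X closure_of W \<subseteq> topspace X - V" by (simp add: closure_of_minimal)
  then have "X closure_of W \<subseteq> U" using W(4) by blast
  then show thesis using that W by blast
qed

lemma finite_subset_incseq_UN:
  fixes \<P> :: "nat \<Rightarrow> 'a set"
  assumes "finite \<Q>" "\<Q> \<subseteq> (\<Union>n. \<P> n)" "\<And>m n. m \<le> n \<Longrightarrow> \<P> m \<subseteq> \<P> n"
  obtains n where "\<Q> \<subseteq> \<P> n"
proof -
  have "\<forall>P\<in>\<Q>. \<exists>n. P \<in> \<P> n" using assms(2) by blast
  then obtain f where f: "\<And>P. P \<in> \<Q> \<Longrightarrow> P \<in> \<P> (f P)" by metis
  have "f P \<le> Max (f ` \<Q>)" if "P \<in> \<Q>" for P using assms(1) that by simp
  then have "\<Q> \<subseteq> \<P> (Max (f ` \<Q>))" using f assms(3) by blast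
  then show thesis using that by blast
qed

text \<open>Increasing levels allow a finite cover to come from one \<open>\<P> n\<close>, so that
  only the one set \<open>inf_points X (\<P> n)\<close> has to be repaired for it.\<close>

locale closed_hcp_k_network =
  fixes X :: "'a topology" and \<P> :: "nat \<Rightarrow> 'a set set"
  assumes regular: "regular_space X"
    and t1: "t1_space X"
    and hcp: "hcp X (\<P> n)"
    and closed: "P \<in> \<P> n \<Longrightarrow> closedin X P"
    and mono: "m \<le> n \<Longrightarrow> \<P> m \<subseteq> \<P> n"
    and network: "compactin X K \<Longrightarrow> openin X U \<Longrightarrow> K \<subseteq> U \<Longrightarrow>
      \<exists>n \<Q>. finite \<Q> \<and> \<Q> \<subseteq> \<P> n \<and> K \<subseteq> \<Union>\<Q> \<and> \<Union>\<Q> \<subseteq> U"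

lemma closed_hcp_k_network_exists:
  assumes "regular_space X" "t1_space X" "has_sigma_hcp_k_network X"
  obtains \<P> where "closed_hcp_k_network X \<P>"
proof -
  obtain \<P> where P: "k_network X (\<Union>n::nat. \<P> n)" "\<And>n. hcp X (\<P> n)"
    using assms(3) unfolding has_sigma_hcp_k_network_def sigma_hcp_def by blast
  define \<R> where "\<R> n = (\<Union>i\<le>n. (\<lambda>P. X closure_of P) ` \<P> i)" for n
  have sub: "P \<subseteq> topspace X" if "P \<in> \<P> n" for P n
    using P(1) that unfolding k_network_def by blast
  have mono: "\<R> m \<subseteq> \<R> n" if "m \<le> n" for m n
    unfolding \<R>_def using that by (intro UN_mono) auto
  have "closed_hcp_k_network X \<R>"
  proof
    show "hcp X (\<R> n)" for n
      unfolding \<R>_def by (intro hcp_finite_UN hcp_closure assms(1) P(2) sub) auto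
    show "closedin X P" if "P \<in> \<R> n" for P n using that by (auto simp: \<R>_def)
    fix K U assume K: "compactin X K" "openin X U" "K \<subseteq> U"
    obtain W where W: "openin X W" "K \<subseteq> W" "X closure_of W \<subseteq> U"
      using regular_space_compact_nhd[OF assms(1) K] .
    obtain \<Q> where Q: "\<Q> \<subseteq> (\<Union>n. \<P> n)" "finite \<Q>" "K \<subseteq> \<Union>\<Q>" "\<Union>\<Q> \<subseteq> W"
      using P(1) K(1) W(1,2) unfolding k_network_def by meson
    let ?Q = "(\<lambda>P. X closure_of P) ` \<Q>"
    have "(\<lambda>P. X closure_of P) ` \<P> n \<subseteq> \<R> n" for n
      unfolding \<R>_def by (rule UN_upper) simp
    then have "(\<Union>n. (\<lambda>P. X closure_of P) ` \<P> n) \<subseteq> (\<Union>n. \<R> n)" by (rule UN_mono[OF order_refl])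
    then have "?Q \<subseteq> (\<Union>n. \<R> n)" using image_mono[OF Q(1)] by (metis image_UN order_trans)
    then obtain n where n: "?Q \<subseteq> \<R> n"
      by (rule finite_subset_incseq_UN[OF finite_imageI[OF Q(2)] _ mono]) (assumption | rule that)+
    have "K \<subseteq> \<Union>?Q"
    proof
      fix x assume "x \<in> K"
      then obtain P where "P \<in> \<Q>" "x \<in> P" using Q(3) by blast
      moreover have "P \<subseteq> X closure_of P" using sub Q(1) \<open>P \<in> \<Q>\<close> by (intro closure_of_subset) blast
      ultimately show "x \<in> \<Union>?Q" by blast
    qed
    moreover have "\<Union>?Q \<subseteq> U"
    proof (rule UN_least)
      fix P assume "P \<in> \<Q>"
      then have "X closure_of P \<subseteq> X closure_of W" using Q(4) by (intro closure_of_mono) blast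
      then show "X closure_of P \<subseteq> U" using W(3) by blast
    qed
    ultimately show "\<exists>n \<Q>. finite \<Q> \<and> \<Q> \<subseteq> \<R> n \<and> K \<subseteq> \<Union>\<Q> \<and> \<Union>\<Q> \<subseteq> U"
      using n Q(2) by (meson finite_imageI)
  qed (use assms mono in auto)
  then show thesis by (rule that)
qed

text \<open>For fixed \<open>l\<close> and \<open>j\<close> the sets \<open>R l j e\<close> are
  locally finite as a family indexed by \<open>e\<close>. They are not neighbourhoods of
  \<open>e\<close>: each compact \<open>K\<close> is caught near \<open>e\<close> by a pair
  \<open>l\<close>, \<open>j\<close> depending on \<open>K\<close> and \<open>e\<close>, which is as
  much as a k-network can see.\<close>

definition local_expansion :: "'a topology \<Rightarrow> 'a set \<Rightarrow> (nat \<Rightarrow> nat \<Rightarrow> 'a \<Rightarrow> 'a set) \<Rightarrow> bool" where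
  "local_expansion X E R \<longleftrightarrow> (\<forall>l j e. R l j e \<subseteq> topspace X) \<and>
     (\<forall>l j. \<forall>x\<in>topspace X. \<exists>V. openin X V \<and> x \<in> V \<and> finite {e \<in> E. R l j e \<inter> V \<noteq> {}}) \<and>
     (\<forall>K e. compactin X K \<and> e \<in> E \<longrightarrow> (\<exists>l j V. openin X V \<and> e \<in> V \<and> K \<inter> V \<subseteq> R l j e))"

section \<open>Exhaustion of open sets and expansion of the exceptional points\<close>

context closed_hcp_k_network
begin

text \<open>Makes an open \<open>G\<close> an increasing union of closed sets, one of which absorbs
  any given compact subset of \<open>G\<close>. With \<open>G\<close> the complement of a point this
  shows that points are of type G-delta.\<close>

definition exhaustion :: "'a set \<Rightarrow> nat \<Rightarrow> 'a set" where
  "exhaustion G j = \<Union>{P \<in> \<P> j. P \<subseteq> G}"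

lemma closedin_exhaustion: "closedin X (exhaustion G j)"
  unfolding exhaustion_def by (rule hcp_closedin_Union[OF hcp closed]) auto

lemma exhaustion_subset: "exhaustion G j \<subseteq> G"
  by (auto simp: exhaustion_def)

lemma compact_subset_exhaustion:
  assumes "compactin X K" "openin X G" "K \<subseteq> G"
  obtains j where "K \<subseteq> exhaustion G j"
proof -
  obtain n \<Q> where "\<Q> \<subseteq> \<P> n" "K \<subseteq> \<Union>\<Q>" "\<Union>\<Q> \<subseteq> G" using network[OF assms] by metis
  then have "K \<subseteq> exhaustion G n" unfolding exhaustion_def by blast
  then show thesis by (rule that)
qed

lemma openin_Diff_singleton:
  assumes "openin X U" shows "openin X (U - {x})"
proof (cases "x \<in> topspace X")
  case True then show ?thesis using assms closedin_t1_singleton[OF t1] by (intro openin_diff)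
next
  case False then have "U - {x} = U" using openin_subset[OF assms] by blast
  then show ?thesis using assms by simp
qed

text \<open>The \<open>m\<close>-th piece collects the points that have a member of \<open>\<P> m\<close> inside their \<open>hcp_nhd\<close>.
  Nearby points of one piece lie in the same members of \<open>\<P> n\<close>, so near any point the piece is
  contained in infinitely many members at once; the points of \<open>X\<close> being \<open>G\<^sub>\<delta>\<close>, it can be cut into
  countably many parts that stay away from the point, one for each of these members.\<close>
lemma inf_points_decomposition:
  obtains E :: "nat \<Rightarrow> 'a set"
  where "inf_points X (\<P> n) = (\<Union>m. E m)" "\<And>m A. A \<subseteq> E m \<Longrightarrow> closedin X A"
proof
  define E where
    "E m = {x \<in> inf_points X (\<P> n). \<exists>F\<in>\<P> m. x \<in> F \<and> F \<subseteq> hcp_nhd X (\<P> n) x}" for m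
  show "inf_points X (\<P> n) = (\<Union>m. E m)"
  proof
    show "inf_points X (\<P> n) \<subseteq> (\<Union>m. E m)"
    proof
      fix x assume x: "x \<in> inf_points X (\<P> n)"
      then have "x \<in> topspace X" by (simp add: inf_points_def)
      then have "compactin X {x}" "{x} \<subseteq> hcp_nhd X (\<P> n) x" by (simp_all add: mem_hcp_nhd)
      then obtain m \<Q> where "\<Q> \<subseteq> \<P> m" "{x} \<subseteq> \<Union>\<Q>" "\<Union>\<Q> \<subseteq> hcp_nhd X (\<P> n) x"
        using network[OF _ openin_hcp_nhd[OF hcp closed]] by meson
      then obtain F where "F \<in> \<P> m" "x \<in> F" "F \<subseteq> hcp_nhd X (\<P> n) x" by auto
      then have "x \<in> E m" using x unfolding E_def by blast
      then show "x \<in> (\<Union>m. E m)" by blast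
    qed
  qed (auto simp: E_def)
  fix m A assume A: "A \<subseteq> E m"
  have AX: "A \<subseteq> topspace X" using A by (auto simp: E_def inf_points_def)
  have "openin X (topspace X - A)"
  proof (subst openin_subopen, intro ballI)
    fix y assume y: "y \<in> topspace X - A"
    define N where "N = hcp_nhd X (\<P> n) y \<inter> hcp_nhd X (\<P> m) y"
    have N: "openin X N" unfolding N_def by (intro openin_Int openin_hcp_nhd[OF hcp closed])
    have yN: "y \<in> N" using y by (simp add: N_def mem_hcp_nhd)
    \<comment> \<open>Nearness becomes symmetric: the witness \<open>F\<close> of \<open>z\<close>
      belongs to \<open>\<P> m\<close>, so \<open>z \<in> N\<close> forces \<open>y \<in> F\<close>,
      and \<open>F\<close> lies in the neighbourhood of \<open>z\<close>.\<close>
    have same: "{P \<in> \<P> n. z \<in> P} = {P \<in> \<P> n. y \<in> P}" if z: "z \<in> A \<inter> N" for z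
    proof -
      obtain F where F: "F \<in> \<P> m" "z \<in> F" "F \<subseteq> hcp_nhd X (\<P> n) z" using z A by (auto simp: E_def)
      have "y \<in> F" using z F(1,2) by (auto simp: N_def mem_hcp_nhd)
      then have "y \<in> hcp_nhd X (\<P> n) z" using F(3) by blast
      then show ?thesis using z by (auto simp: N_def mem_hcp_nhd)
    qed
    show "\<exists>T. openin X T \<and> y \<in> T \<and> T \<subseteq> topspace X - A"
    proof (cases "A \<inter> N = {}")
      case True
      then show ?thesis using N yN openin_subset[OF N] by (intro exI[of _ N]) auto
    next
      case False
      then obtain z where z: "z \<in> A \<inter> N" by blast
      then have "infinite {P \<in> \<P> n. z \<in> P}" using A by (auto simp: E_def inf_points_def)
      then have "infinite {P \<in> \<P> n. y \<in> P}" using same[OF z] by simp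
      then obtain p :: "nat \<Rightarrow> 'a set" where p: "inj p" "range p \<subseteq> {P \<in> \<P> n. y \<in> P}"
        using infinite_countable_subset by blast
      define S where
        "S P = (if P \<in> range p then A \<inter> N \<inter> exhaustion (topspace X - {y}) (inv p P) else {})" for P
      have SP: "S P \<subseteq> P" for P
      proof
        fix w assume "w \<in> S P"
        then have "P \<in> range p" "w \<in> A \<inter> N" by (auto simp: S_def split: if_splits)
        then have "P \<in> {P \<in> \<P> n. w \<in> P}" using p(2) same by blast
        then show "w \<in> P" by blast
      qed
      have AN: "A \<inter> N \<subseteq> (\<Union>P\<in>\<P> n. S P)"
      proof
        fix x assume x: "x \<in> A \<inter> N"
        have "compactin X {x}" "{x} \<subseteq> topspace X - {y}" using x y AX by auto
        then obtain j where "{x} \<subseteq> exhaustion (topspace X - {y}) j"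
          using compact_subset_exhaustion[OF _ openin_Diff_singleton[OF openin_topspace]] by metis
        then have "x \<in> S (p j)" using x p(1) by (simp add: S_def)
        then show "x \<in> (\<Union>P\<in>\<P> n. S P)" using p(2) by blast
      qed
      have "y \<notin> X closure_of (S P)" for P
      proof -
        have "S P \<subseteq> exhaustion (topspace X - {y}) (inv p P)" by (simp add: S_def)
        then have "X closure_of (S P) \<subseteq> exhaustion (topspace X - {y}) (inv p P)"
          by (intro closure_of_minimal closedin_exhaustion)
        then show ?thesis using exhaustion_subset by fast
      qed
      then have y': "y \<notin> X closure_of (\<Union>P\<in>\<P> n. S P)"
        by (subst hcp_closure_of_UN[OF hcp SP]) auto
      have "A \<inter> N \<subseteq> X closure_of (A \<inter> N)" using AX by (intro closure_of_subset) blast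
      also have "\<dots> \<subseteq> X closure_of (\<Union>P\<in>\<P> n. S P)" using AN by (rule closure_of_mono)
      finally have "N - X closure_of (\<Union>P\<in>\<P> n. S P) \<subseteq> topspace X - A"
        using openin_subset[OF N] by blast
      moreover have "openin X (N - X closure_of (\<Union>P\<in>\<P> n. S P))"
        using N by (intro openin_diff closedin_closure_of)
      ultimately show ?thesis using y' yN by (metis DiffI)
    qed
  qed
  then show "closedin X A" using AX by (simp add: closedin_def)
qed

text \<open>Collect in \<open>R0 l e\<close> the members of \<open>\<P> l\<close> that meet
  \<open>E\<close> in \<open>e\<close> alone. These unions are again closed and HCP, and a point of
  \<open>E\<close> lies in at most one of them, so the closed set \<open>\<Delta> l\<close> where
  they accumulate misses \<open>E\<close>. Restricting to an exhaustion of its complement yields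
  local finiteness and loses nothing of a compact set near \<open>e\<close>.\<close>

lemma local_expansion_exists:
  assumes E: "\<And>A. A \<subseteq> E \<Longrightarrow> closedin X A"
  shows "\<exists>R. local_expansion X E R"
proof -
  define R0 where "R0 l e = \<Union>{P \<in> \<P> l. P \<inter> E = {e}}" for l e
  define \<Delta> where "\<Delta> l = inf_points X (R0 l ` E)" for l
  define R where "R l j e = R0 l e \<inter> exhaustion (topspace X - \<Delta> l) j" for l j e
  have R0_closed: "closedin X (R0 l e)" for l e
    unfolding R0_def by (rule hcp_closedin_Union[OF hcp closed]) auto
  have R0_E: "e' = e" if "e' \<in> R0 l e" "e' \<in> E" for e e' l
    using that by (auto simp: R0_def)
  have R0_mem: "e \<in> R0 l e" if "R0 l e \<noteq> {}" for e l
    using that by (auto simp: R0_def)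
  have R0_hcp: "hcp X (R0 l ` E)" for l
    unfolding hcp_iff
  proof (intro allI impI subsetI)
    fix S x
    assume S: "\<forall>P\<in>R0 l ` E. S P \<subseteq> P" and x: "x \<in> X closure_of (\<Union>P\<in>R0 l ` E. S P)"
    \<comment> \<open>A member \<open>P\<close> determines the \<open>e\<close> with
      \<open>P \<inter> E = {e}\<close>, so a choice from the unions \<open>R0 l e\<close> splits
      into a choice from the members of \<open>\<P> l\<close>.\<close>
    define T where "T P = {z \<in> P. \<exists>e\<in>E. P \<inter> E = {e} \<and> z \<in> S (R0 l e)}" for P
    have "S (R0 l e) \<subseteq> (\<Union>P\<in>\<P> l. T P)" if e: "e \<in> E" for e
    proof
      fix z assume z: "z \<in> S (R0 l e)"
      then have "z \<in> R0 l e" using S e by blast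
      then obtain P where "P \<in> \<P> l" "P \<inter> E = {e}" "z \<in> P" by (auto simp: R0_def)
      then show "z \<in> (\<Union>P\<in>\<P> l. T P)" using z e by (auto simp: T_def)
    qed
    then have "(\<Union>P\<in>R0 l ` E. S P) \<subseteq> (\<Union>P\<in>\<P> l. T P)" by auto
    then have "x \<in> X closure_of (\<Union>P\<in>\<P> l. T P)" using x closure_of_mono by fast
    then have "x \<in> (\<Union>P\<in>\<P> l. X closure_of (T P))"
      by (subst (asm) hcp_closure_of_UN[OF hcp]) (auto simp: T_def)
    then obtain P where P: "P \<in> \<P> l" "x \<in> X closure_of (T P)" by blast
    then have "T P \<noteq> {}" by auto
    then obtain e where e: "e \<in> E" "P \<inter> E = {e}" by (auto simp: T_def)
    then have "T P \<subseteq> S (R0 l e)" by (auto simp: T_def)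
    then have "x \<in> X closure_of (S (R0 l e))" using P(2) closure_of_mono by fast
    then show "x \<in> (\<Union>P\<in>R0 l ` E. X closure_of (S P))" using e(1) by blast
  qed
  have R0_cl: "closedin X P" if "P \<in> R0 l ` E" for P l
    using that R0_closed by fast
  have Delta_closed: "closedin X (\<Delta> l)" for l
    unfolding \<Delta>_def by (rule closedin_inf_points[OF R0_hcp R0_cl])
  have Delta_E: "e \<notin> \<Delta> l" if "e \<in> E" for e l
  proof
    assume "e \<in> \<Delta> l"
    then have "infinite {P \<in> R0 l ` E. e \<in> P}" by (simp add: \<Delta>_def inf_points_def)
    moreover have "{P \<in> R0 l ` E. e \<in> P} \<subseteq> {R0 l e}" using R0_E that by blast
    ultimately show False using finite_subset by blast
  qed
  have "R l j e \<subseteq> topspace X" for l j e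
    using closedin_subset[OF R0_closed] by (auto simp: R_def)
  moreover have "\<exists>V. openin X V \<and> x \<in> V \<and> finite {e \<in> E. R l j e \<inter> V \<noteq> {}}" if x: "x \<in> topspace X" for l j x
  proof -
    let ?F = "exhaustion (topspace X - \<Delta> l) j"
    have "?F \<inter> inf_points X (R0 l ` E) = {}" using exhaustion_subset by (fastforce simp: \<Delta>_def)
    note locally_finite_off_inf_points[OF R0_hcp R0_cl[where l=l] closedin_exhaustion this x]
    then obtain V where V: "openin X V" "x \<in> V" "finite {P \<in> R0 l ` E. P \<inter> ?F \<inter> V \<noteq> {}}" by auto
    have "R0 l ` {e \<in> E. R l j e \<inter> V \<noteq> {}} \<subseteq> {P \<in> R0 l ` E. P \<inter> ?F \<inter> V \<noteq> {}}"
      by (auto simp: R_def)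
    then have "finite (R0 l ` {e \<in> E. R l j e \<inter> V \<noteq> {}})" using V(3) by (rule finite_subset)
    \<comment> \<open>The claim counts indices rather than sets; a nonempty \<open>R0 l e\<close>
      contains \<open>e\<close> and no other point of \<open>E\<close>, so it determines its
      index.\<close>
    moreover have "inj_on (R0 l) {e \<in> E. R l j e \<inter> V \<noteq> {}}"
    proof (rule inj_onI)
      fix e e' assume "e \<in> {e \<in> E. R l j e \<inter> V \<noteq> {}}" "e' \<in> {e \<in> E. R l j e \<inter> V \<noteq> {}}" "R0 l e = R0 l e'"
      then have "e \<in> R0 l e'" "e \<in> E" using R0_mem[of l e] by (auto simp: R_def)
      then show "e = e'" by (rule R0_E)
    qed
    ultimately have "finite {e \<in> E. R l j e \<inter> V \<noteq> {}}" by (rule finite_imageD)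
    then show ?thesis using V(1,2) by metis
  qed
  moreover have "\<exists>l j V. openin X V \<and> e \<in> V \<and> K \<inter> V \<subseteq> R l j e" if K: "compactin X K" and e: "e \<in> E" for K e
  proof -
    have "closedin X E" by (rule E) simp
    have eX: "e \<in> topspace X" using closedin_subset[OF \<open>closedin X E\<close>] e by blast
    have "closedin X (E - {e})" by (rule E) blast
    then have O: "openin X (topspace X - (E - {e}))" by (intro openin_diff openin_topspace)
    obtain W where W: "openin X W" "e \<in> W" "X closure_of W \<subseteq> topspace X - (E - {e})"
      by (rule regular_space_nhd[OF regular O]) (use eX in blast)
    have "compactin X (K \<inter> X closure_of W)" using K by (intro compact_Int_closedin closedin_closure_of)
    then obtain l \<Q> where Q: "finite \<Q>" "\<Q> \<subseteq> \<P> l" "K \<inter> X closure_of W \<subseteq> \<Union>\<Q>" "\<Union>\<Q> \<subseteq> topspace X - (E - {e})"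
      using network[OF _ O] W(3) by (metis inf.coboundedI2)
    \<comment> \<open>Inside \<open>V1\<close> only covering members through \<open>e\<close>
      remain. They avoid \<open>E - {e}\<close>, hence meet \<open>E\<close> exactly in
      \<open>e\<close> and were collected in \<open>R0 l e\<close>.\<close>
    define V1 where "V1 = topspace X - \<Union>{P \<in> \<Q>. e \<notin> P}"
    have V1: "openin X V1"
      unfolding V1_def using Q(2) closed by (intro openin_diff openin_topspace hcp_closedin_Union[OF hcp[of l]]) auto
    have "openin X (topspace X - \<Delta> l)" using Delta_closed by (intro openin_diff openin_topspace)
    then obtain W2 where W2: "openin X W2" "e \<in> W2" "X closure_of W2 \<subseteq> topspace X - \<Delta> l"
      by (rule regular_space_nhd[OF regular]) (use eX Delta_E[OF e] in blast)
    have "compactin X (K \<inter> X closure_of W2)" using K by (intro compact_Int_closedin closedin_closure_of)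
    then obtain j where j: "K \<inter> X closure_of W2 \<subseteq> exhaustion (topspace X - \<Delta> l) j"
      using compact_subset_exhaustion[OF _ \<open>openin X (topspace X - \<Delta> l)\<close>] W2(3) by (metis inf.coboundedI2)
    have "K \<inter> (W \<inter> V1 \<inter> W2) \<subseteq> R l j e"
    proof
      fix z assume z: "z \<in> K \<inter> (W \<inter> V1 \<inter> W2)"
      have "z \<in> X closure_of W" "z \<in> X closure_of W2"
        using z closure_of_subset[OF openin_subset] W(1) W2(1) by fast+
      then obtain P where P: "P \<in> \<Q>" "z \<in> P" "z \<in> exhaustion (topspace X - \<Delta> l) j"
        using z Q(3) j by blast
      then have "e \<in> P" using z by (auto simp: V1_def)
      then have "P \<inter> E = {e}" using e P(1) Q(4) by blast
      then show "z \<in> R l j e" using P Q(2) by (auto simp: R_def R0_def)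
    qed
    moreover have "openin X (W \<inter> V1 \<inter> W2)" using W(1) V1 W2(1) by (intro openin_Int)
    moreover have "e \<in> W \<inter> V1 \<inter> W2" using W(2) W2(2) eX by (auto simp: V1_def)
    ultimately show ?thesis by metis
  qed
  ultimately show ?thesis unfolding local_expansion_def by (intro exI[of _ R]) simp
qed

end

section \<open>Assembling the sigma-locally finite k-network\<close>

lemma sigma_locally_finite_countable:
  assumes "countable \<C>" "\<C> \<noteq> {}" "\<And>\<A>. \<A> \<in> \<C> \<Longrightarrow> locally_finite_in X \<A>"
  shows "sigma_locally_finite X (\<Union>\<C>)"
  unfolding sigma_locally_finite_def
proof (intro exI[of _ "from_nat_into \<C>"] conjI allI)
  show "\<Union>\<C> = (\<Union>n. from_nat_into \<C> n)" using assms(1,2) by simp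
  show "locally_finite_in X (from_nat_into \<C> n)" for n using assms from_nat_into by metis
qed

text \<open>A countable k-network localised at \<open>x\<close>: the sets chosen must lie in
  \<open>U\<close>, but only the part of \<open>K\<close> in some neighbourhood of \<open>x\<close>
  has to be covered.\<close>

definition countable_k_network_at :: "'a topology \<Rightarrow> 'a \<Rightarrow> (nat \<Rightarrow> 'a set) \<Rightarrow> bool" where
  "countable_k_network_at X x C \<longleftrightarrow>
     (\<forall>K U. compactin X K \<and> x \<in> K \<and> openin X U \<and> x \<in> U \<longrightarrow>
        (\<exists>I V. finite I \<and> openin X V \<and> x \<in> V \<and> K \<inter> V \<subseteq> (\<Union>i\<in>I. C i) \<and> (\<Union>i\<in>I. C i) \<subseteq> U))"

text \<open>A compact set meets \<open>inf_points X (\<P> n)\<close> in finitely many points. Near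
  each of them it is covered by sets of \<open>\<B>\<close>, and what remains by sets of
  \<open>\<A>\<close>, which live off \<open>inf_points\<close>. All indices are natural numbers, so
  countably many locally finite families suffice.\<close>

theorem (in closed_hcp_k_network) aleph_space_if_locally_countable:
  assumes "\<And>x. x \<in> topspace X \<Longrightarrow> \<exists>C. countable_k_network_at X x C"
  shows "aleph_space X"
proof -
  obtain C where C: "\<And>x. x \<in> topspace X \<Longrightarrow> countable_k_network_at X x (C x)"
    using assms by metis
  have "\<exists>E::nat \<Rightarrow> 'a set. inf_points X (\<P> n) = (\<Union>m. E m) \<and> (\<forall>m A. A \<subseteq> E m \<longrightarrow> closedin X A)" for n
    using inf_points_decomposition[of n] by metis
  then obtain E :: "nat \<Rightarrow> nat \<Rightarrow> 'a set" where E: "\<And>n. inf_points X (\<P> n) = (\<Union>m. E n m)"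
      "\<And>n m A. A \<subseteq> E n m \<Longrightarrow> closedin X A"
    by metis
  have "\<exists>R. local_expansion X (E n m) R" for n m
    by (rule local_expansion_exists) (rule E(2))
  then obtain R where R: "\<And>n m. local_expansion X (E n m) (R n m)" by metis
  have R1: "R n m l j e \<subseteq> topspace X" for n m l j e
    using R[of n m] by (simp add: local_expansion_def)
  have R2: "\<exists>V. openin X V \<and> x \<in> V \<and> finite {e \<in> E n m. R n m l j e \<inter> V \<noteq> {}}"
    if "x \<in> topspace X" for n m l j x
    using R[of n m] that by (simp add: local_expansion_def)
  have R3: "\<exists>l j V. openin X V \<and> e \<in> V \<and> K \<inter> V \<subseteq> R n m l j e" if "compactin X K" "e \<in> E n m" for n m K e
    using R[of n m] that by (simp add: local_expansion_def)
  define G where "G n = topspace X - inf_points X (\<P> n)" for n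
  have G: "openin X (G n)" for n
    unfolding G_def by (intro openin_diff openin_topspace closedin_inf_points[OF hcp closed])
  define \<A> where "\<A> n j = (\<lambda>P. P \<inter> exhaustion (G n) j) ` \<P> n" for n j
  \<comment> \<open>The families \<open>C e\<close> at different \<open>e\<close> are unrelated;
    with \<open>i\<close> fixed each \<open>e\<close> contributes a single set inside
    \<open>R n m l j e\<close>, and local finiteness is inherited from the expansion.\<close>
  define \<B> where "\<B> n m l j i = (\<lambda>e. C e i \<inter> R n m l j e) ` E n m" for n m l j i
  define \<C> where "\<C> = range (\<lambda>(n, j). \<A> n j) \<union> range (\<lambda>(n, m, l, j, i). \<B> n m l j i)"
  have A_lf: "locally_finite_in X (\<A> n j)" for n j
    unfolding locally_finite_in_def
  proof (intro conjI ballI)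
    show "\<Union>(\<A> n j) \<subseteq> topspace X" using closedin_subset[OF closed] by (auto simp: \<A>_def)
    fix x assume x: "x \<in> topspace X"
    have "exhaustion (G n) j \<inter> inf_points X (\<P> n) = {}"
      using exhaustion_subset by (fastforce simp: G_def)
    note locally_finite_off_inf_points[OF hcp closed[where n=n] closedin_exhaustion this x]
    then obtain V where V: "openin X V" "x \<in> V" "finite {P \<in> \<P> n. P \<inter> exhaustion (G n) j \<inter> V \<noteq> {}}" by auto
    have "{U \<in> \<A> n j. U \<inter> V \<noteq> {}} \<subseteq> (\<lambda>P. P \<inter> exhaustion (G n) j) ` {P \<in> \<P> n. P \<inter> exhaustion (G n) j \<inter> V \<noteq> {}}"
      by (auto simp: \<A>_def)
    with V(3) have "finite {U \<in> \<A> n j. U \<inter> V \<noteq> {}}" by (rule finite_surj)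
    then show "\<exists>V. openin X V \<and> x \<in> V \<and> finite {U \<in> \<A> n j. U \<inter> V \<noteq> {}}" using V(1,2) by metis
  qed
  have B_lf: "locally_finite_in X (\<B> n m l j i)" for n m l j i
    unfolding locally_finite_in_def
  proof (intro conjI ballI)
    show "\<Union>(\<B> n m l j i) \<subseteq> topspace X" using R1 by (fastforce simp: \<B>_def)
    fix x assume "x \<in> topspace X"
    from R2[OF this, of n m l j]
    obtain V where V: "openin X V" "x \<in> V" "finite {e \<in> E n m. R n m l j e \<inter> V \<noteq> {}}"
      by (elim exE conjE) (rule that)
    have "{U \<in> \<B> n m l j i. U \<inter> V \<noteq> {}} \<subseteq> (\<lambda>e. C e i \<inter> R n m l j e) ` {e \<in> E n m. R n m l j e \<inter> V \<noteq> {}}"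
      by (auto simp: \<B>_def)
    with V(3) have "finite {U \<in> \<B> n m l j i. U \<inter> V \<noteq> {}}" by (rule finite_surj)
    then show "\<exists>V. openin X V \<and> x \<in> V \<and> finite {U \<in> \<B> n m l j i. U \<inter> V \<noteq> {}}" using V(1,2) by metis
  qed
  have lf: "locally_finite_in X \<D>" if "\<D> \<in> \<C>" for \<D>
    using that A_lf B_lf by (auto simp: \<C>_def)
  have "sigma_locally_finite X (\<Union>\<C>)"
    by (rule sigma_locally_finite_countable[OF _ _ lf]) (auto simp: \<C>_def)
  moreover have "k_network X (\<Union>\<C>)"
    unfolding k_network_def
  proof (intro conjI allI impI ballI)
    show "P \<subseteq> topspace X" if "P \<in> \<Union>\<C>" for P using that lf by (fastforce simp: locally_finite_in_def)
    fix K U assume KU: "compactin X K \<and> openin X U \<and> K \<subseteq> U"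
    then obtain n \<Q> where Q: "finite \<Q>" "\<Q> \<subseteq> \<P> n" "K \<subseteq> \<Union>\<Q>" "\<Union>\<Q> \<subseteq> U"
      using network[of K U] by metis
    let ?D = "K \<inter> inf_points X (\<P> n)"
    have finD: "finite ?D" using finite_compact_Int_inf_points[OF t1 hcp] KU by metis
    have "\<exists>V \<G>. openin X V \<and> e \<in> V \<and> finite \<G> \<and> \<G> \<subseteq> \<Union>\<C> \<and> K \<inter> V \<subseteq> \<Union>\<G> \<and> \<Union>\<G> \<subseteq> U" if e: "e \<in> ?D" for e
    proof -
      obtain m where m: "e \<in> E n m" using e E(1) by blast
      have "e \<in> topspace X" using e by (simp add: inf_points_def)
      moreover have "e \<in> K" "e \<in> U" using e KU by blast+
      ultimately obtain I V where I: "finite I" "openin X V" "e \<in> V" "K \<inter> V \<subseteq> (\<Union>i\<in>I. C e i)" "(\<Union>i\<in>I. C e i) \<subseteq> U"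
        using C KU unfolding countable_k_network_at_def by metis
      obtain l j V' where V': "openin X V'" "e \<in> V'" "K \<inter> V' \<subseteq> R n m l j e"
        using R3[OF _ m] KU by metis
      let ?\<G> = "(\<lambda>i. C e i \<inter> R n m l j e) ` I"
      have "C e i \<inter> R n m l j e \<in> \<Union>\<C>" for i
      proof (rule UnionI)
        show "\<B> n m l j i \<in> \<C>" unfolding \<C>_def by (rule UnI2, rule range_eqI[of _ _ "(n, m, l, j, i)"]) simp
        show "C e i \<inter> R n m l j e \<in> \<B> n m l j i" using m unfolding \<B>_def by blast
      qed
      then have "?\<G> \<subseteq> \<Union>\<C>" by (rule image_subsetI)
      moreover have "K \<inter> (V \<inter> V') \<subseteq> \<Union>?\<G>" "\<Union>?\<G> \<subseteq> U" using I(4,5) V'(3) by blast+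
      moreover have "openin X (V \<inter> V')" using I(2) V'(1) by (rule openin_Int)
      ultimately show ?thesis using I(1,3) V'(2) by (meson IntI finite_imageI)
    qed
    then obtain V \<G> where V: "\<And>e. e \<in> ?D \<Longrightarrow> openin X (V e) \<and> e \<in> V e \<and> finite (\<G> e) \<and> \<G> e \<subseteq> \<Union>\<C> \<and>
        K \<inter> V e \<subseteq> \<Union>(\<G> e) \<and> \<Union>(\<G> e) \<subseteq> U"
      by metis
    have VD: "\<G> e \<subseteq> \<Union>\<C>" "\<Union>(\<G> e) \<subseteq> U" "finite (\<G> e)" "openin X (V e)" if "e \<in> ?D" for e
      using V[OF that] by simp_all
    have "openin X (\<Union>(V ` ?D))" using VD(4) by (intro openin_Union) (elim imageE, simp)
    \<comment> \<open>With neighbourhoods of the exceptional points removed, the rest of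
      \<open>K\<close> is a compact subset of \<open>G n\<close>, so one stage \<open>j\<close> of
      the exhaustion contains it.\<close>
    then have "compactin X (K \<inter> (topspace X - \<Union>(V ` ?D)))"
      using KU by (intro compact_Int_closedin closedin_diff closedin_topspace) auto
    moreover have "K \<inter> (topspace X - \<Union>(V ` ?D)) \<subseteq> G n" using V by (auto simp: G_def)
    ultimately obtain j where j: "K \<inter> (topspace X - \<Union>(V ` ?D)) \<subseteq> exhaustion (G n) j"
      using compact_subset_exhaustion[OF _ G] by metis
    let ?\<H> = "(\<lambda>P. P \<inter> exhaustion (G n) j) ` \<Q> \<union> (\<Union>e\<in>?D. \<G> e)"
    have "\<A> n j \<in> \<C>" unfolding \<C>_def by (rule UnI1, rule range_eqI[of _ _ "(n, j)"]) simp
    moreover have "(\<lambda>P. P \<inter> exhaustion (G n) j) ` \<Q> \<subseteq> \<A> n j" using Q(2) by (auto simp: \<A>_def)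
    ultimately have "(\<lambda>P. P \<inter> exhaustion (G n) j) ` \<Q> \<subseteq> \<Union>\<C>" by (meson Union_upper order_trans)
    then have "?\<H> \<subseteq> \<Union>\<C>" using VD(1) by (intro Un_least UN_least)
    moreover have "finite ?\<H>" using Q(1) finD VD(3) by (intro finite_UnI finite_imageI finite_UN_I)
    moreover have "\<Union>?\<H> \<subseteq> U"
    proof -
      have "\<Union>((\<lambda>P. P \<inter> exhaustion (G n) j) ` \<Q>) \<subseteq> U" using Q(4) by blast
      moreover have "\<Union>(\<Union>e\<in>?D. \<G> e) \<subseteq> U" using VD(2) by (meson UN_E Union_least Union_upper order_trans)
      ultimately show ?thesis by (simp only: Union_Un_distrib Un_least)
    qed
    moreover have "K \<subseteq> \<Union>?\<H>"
    proof
      fix z assume z: "z \<in> K"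
      show "z \<in> \<Union>?\<H>"
      proof (cases "z \<in> \<Union>(V ` ?D)")
        case True
        then obtain e where e: "e \<in> ?D" "z \<in> V e" by blast
        then have "z \<in> \<Union>(\<G> e)" using V[OF e(1)] z by blast
        then show ?thesis using e(1) by blast
      next
        case False
        then have "z \<in> exhaustion (G n) j" using j z KU compactin_subset_topspace[of X K] by blast
        moreover obtain P where "P \<in> \<Q>" "z \<in> P" using z Q(3) by blast
        ultimately show ?thesis by blast
      qed
    qed
    ultimately show "\<exists>\<P>'\<subseteq>\<Union>\<C>. finite \<P>' \<and> K \<subseteq> \<Union>\<P>' \<and> \<Union>\<P>' \<subseteq> U" by metis
  qed
  ultimately show ?thesis unfolding aleph_space_def by metis
qed

section \<open>The Vietoris topology\<close>

lemma openin_vietoris_basic: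
  assumes "finite \<U>" "\<U> \<noteq> {}" "\<And>U. U \<in> \<U> \<Longrightarrow> openin X U"
  shows "openin (vietoris X) (vietoris_basic X \<U>)"
  unfolding vietoris_def
  by (rule topology_generated_by_Basis) (use assms in blast)

text \<open>A \<open>K\<close> in both sets lies in both unions, so cutting each set by the other
  union changes no intersection with \<open>K\<close>. This makes the generating sets a
  base.\<close>

lemma vietoris_basic_Int:
  "vietoris_basic X \<U> \<inter> vietoris_basic X \<V> =
   vietoris_basic X ((\<lambda>U. U \<inter> \<Union>\<V>) ` \<U> \<union> (\<lambda>V. V \<inter> \<Union>\<U>) ` \<V>)" (is "?L = ?R")
proof
  show "?L \<subseteq> ?R"
  proof
    fix K assume K: "K \<in> ?L"
    then have s: "K \<subseteq> \<Union>\<U>" "K \<subseteq> \<Union>\<V>" by (auto simp: vietoris_basic_def)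
    then have "K \<inter> (U \<inter> \<Union>\<V>) = K \<inter> U" "K \<inter> (U \<inter> \<Union>\<U>) = K \<inter> U" for U by fast+
    moreover have "K \<subseteq> \<Union>((\<lambda>U. U \<inter> \<Union>\<V>) ` \<U> \<union> (\<lambda>V. V \<inter> \<Union>\<U>) ` \<V>)"
    proof
      fix x assume "x \<in> K"
      then obtain U V where "U \<in> \<U>" "x \<in> U" "V \<in> \<V>" "x \<in> V" using s by (meson UnionE subsetD)
      then show "x \<in> \<Union>((\<lambda>U. U \<inter> \<Union>\<V>) ` \<U> \<union> (\<lambda>V. V \<inter> \<Union>\<U>) ` \<V>)" by auto
    qed
    ultimately show "K \<in> ?R" using K by (simp add: vietoris_basic_def ball_Un)
  qed
  show "?R \<subseteq> ?L"
  proof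
    fix K assume K: "K \<in> ?R"
    have "\<Union>((\<lambda>U. U \<inter> \<Union>\<V>) ` \<U> \<union> (\<lambda>V. V \<inter> \<Union>\<U>) ` \<V>) \<subseteq> \<Union>\<U> \<inter> \<Union>\<V>" by blast
    moreover have "K \<subseteq> \<Union>((\<lambda>U. U \<inter> \<Union>\<V>) ` \<U> \<union> (\<lambda>V. V \<inter> \<Union>\<U>) ` \<V>)"
      using K unfolding vietoris_basic_def mem_Collect_eq by (elim conjE)
    ultimately have "K \<subseteq> \<Union>\<U> \<inter> \<Union>\<V>" by (rule order_trans[rotated])
    moreover have "\<forall>U\<in>\<U>. K \<inter> (U \<inter> \<Union>\<V>) \<noteq> {}" "\<forall>V\<in>\<V>. K \<inter> (V \<inter> \<Union>\<U>) \<noteq> {}"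
      using K by (simp_all add: vietoris_basic_def ball_Un)
    then have "\<forall>U\<in>\<U>. K \<inter> U \<noteq> {}" "\<forall>V\<in>\<V>. K \<inter> V \<noteq> {}" by fast+
    ultimately show "K \<in> ?L" using K by (simp add: vietoris_basic_def)
  qed
qed

lemma topspace_vietoris: "topspace (vietoris X) = {K. compactin X K \<and> K \<noteq> {}}"
proof
  show "topspace (vietoris X) \<subseteq> {K. compactin X K \<and> K \<noteq> {}}"
    by (auto simp: vietoris_def vietoris_basic_def)
  have "{K. compactin X K \<and> K \<noteq> {}} = vietoris_basic X {topspace X}"
    using compactin_subset_topspace by (fastforce simp: vietoris_basic_def)
  moreover have "openin (vietoris X) (vietoris_basic X {topspace X})"
    by (rule openin_vietoris_basic) auto
  ultimately show "{K. compactin X K \<and> K \<noteq> {}} \<subseteq> topspace (vietoris X)"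
    using openin_subset by metis
qed

lemma vietoris_nhd:
  assumes "openin (vietoris X) \<W>" "K \<in> \<W>"
  obtains \<U> where "finite \<U>" "\<U> \<noteq> {}" "\<forall>U\<in>\<U>. openin X U"
    "K \<in> vietoris_basic X \<U>" "vietoris_basic X \<U> \<subseteq> \<W>"
proof -
  let ?\<S> = "{vietoris_basic X \<U> | \<U>. finite \<U> \<and> \<U> \<noteq> {} \<and> (\<forall>U\<in>\<U>. openin X U)}"
  have "generate_topology_on ?\<S> \<W>"
    using assms(1) unfolding vietoris_def by (rule openin_topology_generated_by)
  then have "\<exists>\<U>. finite \<U> \<and> \<U> \<noteq> {} \<and> (\<forall>U\<in>\<U>. openin X U) \<and> K \<in> vietoris_basic X \<U> \<and> vietoris_basic X \<U> \<subseteq> \<W>"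
    using assms(2)
  proof (induction rule: generate_topology_on.induct)
    case (Int a b)
    obtain \<U> where U: "finite \<U>" "\<U> \<noteq> {}" "\<forall>U\<in>\<U>. openin X U" "K \<in> vietoris_basic X \<U>" "vietoris_basic X \<U> \<subseteq> a"
      using Int by (meson IntD1)
    obtain \<V> where V: "finite \<V>" "\<V> \<noteq> {}" "\<forall>U\<in>\<V>. openin X U" "K \<in> vietoris_basic X \<V>" "vietoris_basic X \<V> \<subseteq> b"
      using Int by (meson IntD2)
    have o: "openin X (\<Union>\<U>)" "openin X (\<Union>\<V>)" using U(3) V(3) by (simp_all add: openin_Union)
    let ?\<N> = "(\<lambda>U. U \<inter> \<Union>\<V>) ` \<U> \<union> (\<lambda>V. V \<inter> \<Union>\<U>) ` \<V>"
    have "finite ?\<N>" "?\<N> \<noteq> {}" using U V by auto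
    moreover have "\<forall>U\<in>?\<N>. openin X U" using U(3) V(3) o by (auto intro: openin_Int)
    moreover have "K \<in> vietoris_basic X ?\<N>" "vietoris_basic X ?\<N> \<subseteq> a \<inter> b"
      using U(4,5) V(4,5) by (subst vietoris_basic_Int[symmetric]; blast)+
    ultimately show ?case by (intro exI[of _ ?\<N>] conjI)
  next
    case (UN \<K>) then show ?case by (meson UnionE Union_upper order_trans)
  next
    case (Basis s)
    then obtain \<U> where "s = vietoris_basic X \<U>" "finite \<U>" "\<U> \<noteq> {}" "\<forall>U\<in>\<U>. openin X U" by blast
    then show ?case using Basis(2) by (intro exI[of _ \<U>]) simp
  qed simp
  then show thesis using that by metis
qed

lemma openin_vietoris_subset:
  assumes "openin X U" shows "openin (vietoris X) {K \<in> topspace (vietoris X). K \<subseteq> U}"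
proof -
  have "{K \<in> topspace (vietoris X). K \<subseteq> U} = vietoris_basic X {U}"
    by (auto simp: vietoris_basic_def topspace_vietoris)
  then show ?thesis using openin_vietoris_basic[of "{U}" X] assms by simp
qed

lemma openin_vietoris_hit:
  assumes "openin X U" shows "openin (vietoris X) {K \<in> topspace (vietoris X). K \<inter> U \<noteq> {}}"
proof -
  have "K \<subseteq> topspace X" "K \<inter> topspace X = K" if "compactin X K" for K
    using compactin_subset_topspace[OF that] by auto
  then have "{K \<in> topspace (vietoris X). K \<inter> U \<noteq> {}} = vietoris_basic X {U, topspace X}"
    by (auto simp: vietoris_basic_def topspace_vietoris)
  then show ?thesis using openin_vietoris_basic[of "{U, topspace X}" X] assms by auto
qed

lemma closedin_vietoris_subset:
  assumes "closedin X C" shows "closedin (vietoris X) {K \<in> topspace (vietoris X). K \<subseteq> C}"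
proof -
  have "topspace (vietoris X) - {K \<in> topspace (vietoris X). K \<subseteq> C} =
      {K \<in> topspace (vietoris X). K \<inter> (topspace X - C) \<noteq> {}}"
    using compactin_subset_topspace by (fastforce simp: topspace_vietoris)
  moreover have "openin X (topspace X - C)" using assms by (simp add: closedin_def)
  ultimately show ?thesis using openin_vietoris_hit unfolding closedin_def by simp
qed

lemma closedin_vietoris_hit:
  assumes "closedin X C" shows "closedin (vietoris X) {K \<in> topspace (vietoris X). K \<inter> C \<noteq> {}}"
proof -
  have "topspace (vietoris X) - {K \<in> topspace (vietoris X). K \<inter> C \<noteq> {}} =
      {K \<in> topspace (vietoris X). K \<subseteq> topspace X - C}"
    using compactin_subset_topspace by (fastforce simp: topspace_vietoris)
  moreover have "openin X (topspace X - C)" using assms by (simp add: closedin_def)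
  ultimately show ?thesis using openin_vietoris_subset unfolding closedin_def by simp
qed

text \<open>Regularity shrinks the union around the compact \<open>K\<close>, and each
  \<open>U\<close> around one point of \<open>K\<close> in it. The closed sets \<open>C\<close> and
  \<open>D U\<close> give regularity of the hyperspace and later cut compact sets into compact
  pieces.\<close>

lemma vietoris_closed_nhd:
  assumes X: "regular_space X" and \<U>: "finite \<U>" "\<And>U. U \<in> \<U> \<Longrightarrow> openin X U"
    and K: "K \<in> vietoris_basic X \<U>"
  obtains \<W> C D where "openin (vietoris X) \<W>" "K \<in> \<W>" "closedin X C" "C \<subseteq> \<Union>\<U>"
    "\<And>U. U \<in> \<U> \<Longrightarrow> closedin X (D U) \<and> D U \<subseteq> U"
    "\<And>L. L \<in> \<W> \<Longrightarrow> L \<subseteq> C \<and> (\<forall>U\<in>\<U>. L \<inter> D U \<noteq> {})"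
proof -
  have K': "compactin X K" "K \<subseteq> \<Union>\<U>" "\<And>U. U \<in> \<U> \<Longrightarrow> K \<inter> U \<noteq> {}"
    using K by (auto simp: vietoris_basic_def)
  have "openin X (\<Union>\<U>)" using \<U>(2) by (rule openin_Union)
  then obtain W where W: "openin X W" "K \<subseteq> W" "X closure_of W \<subseteq> \<Union>\<U>"
    using regular_space_compact_nhd[OF X K'(1)] K'(2) by metis
  have "\<exists>V. openin X V \<and> K \<inter> V \<noteq> {} \<and> X closure_of V \<subseteq> U" if U: "U \<in> \<U>" for U
  proof -
    obtain x where "x \<in> K" "x \<in> U" using K'(3)[OF U] by auto
    then obtain V where "openin X V" "x \<in> V" "X closure_of V \<subseteq> U"
      using regular_space_nhd[OF X \<U>(2)[OF U]] by metis
    then show ?thesis using \<open>x \<in> K\<close> by (intro exI[of _ V]) auto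
  qed
  then obtain V where V: "\<And>U. U \<in> \<U> \<Longrightarrow> openin X (V U) \<and> K \<inter> V U \<noteq> {} \<and> X closure_of (V U) \<subseteq> U"
    by metis
  \<comment> \<open>The sets \<open>V U \<inter> W\<close> alone need not cover \<open>K\<close>;
    adding \<open>W\<close> makes their union exactly \<open>W\<close>.\<close>
  let ?\<W> = "vietoris_basic X (insert W ((\<lambda>U. V U \<inter> W) ` \<U>))"
  show thesis
  proof (rule that[of ?\<W> "X closure_of W" "\<lambda>U. X closure_of (V U)"])
    show "openin (vietoris X) ?\<W>"
      by (rule openin_vietoris_basic) (use \<U>(1) V W(1) in \<open>auto intro: openin_Int\<close>)
    have "K \<inter> (V U \<inter> W) \<noteq> {}" if "U \<in> \<U>" for U using V[OF that] W(2) by blast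
    then show "K \<in> ?\<W>" using K W(2) by (auto simp: vietoris_basic_def)
    show "closedin X (X closure_of W)" "X closure_of W \<subseteq> \<Union>\<U>" using W by auto
    show "closedin X (X closure_of (V U)) \<and> X closure_of (V U) \<subseteq> U" if "U \<in> \<U>" for U
      using V[OF that] by auto
    fix L assume L: "L \<in> ?\<W>"
    have "L \<subseteq> W" using L by (auto simp: vietoris_basic_def)
    moreover have "W \<subseteq> X closure_of W" using openin_subset[OF W(1)] by (rule closure_of_subset)
    moreover have "L \<inter> X closure_of (V U) \<noteq> {}" if "U \<in> \<U>" for U
    proof -
      have "L \<inter> (V U \<inter> W) \<noteq> {}" using L that by (auto simp: vietoris_basic_def)
      moreover have "V U \<subseteq> X closure_of (V U)" using V[OF that] openin_subset closure_of_subset by metis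
      ultimately show ?thesis by blast
    qed
    ultimately show "L \<subseteq> X closure_of W \<and> (\<forall>U\<in>\<U>. L \<inter> X closure_of (V U) \<noteq> {})" by blast
  qed
qed

lemma closedin_vietoris_subset_hits:
  assumes "closedin X C" "\<And>U. U \<in> \<U> \<Longrightarrow> closedin X (D U)"
  shows "closedin (vietoris X) {L \<in> topspace (vietoris X). L \<subseteq> C \<and> (\<forall>U\<in>\<U>. L \<inter> D U \<noteq> {})}"
proof -
  let ?\<C> = "insert {L \<in> topspace (vietoris X). L \<subseteq> C}
    ((\<lambda>U. {L \<in> topspace (vietoris X). L \<inter> D U \<noteq> {}}) ` \<U>)"
  have "closedin (vietoris X) (\<Inter>?\<C>)"
  proof (rule closedin_Inter)
    fix S assume "S \<in> ?\<C>"
    then show "closedin (vietoris X) S"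
      by (elim insertE imageE) (simp_all add: assms closedin_vietoris_subset closedin_vietoris_hit)
  qed simp
  moreover have "\<Inter>?\<C> = {L \<in> topspace (vietoris X). L \<subseteq> C \<and> (\<forall>U\<in>\<U>. L \<inter> D U \<noteq> {})}" by auto
  ultimately show ?thesis by simp
qed

lemma regular_space_vietoris:
  assumes "regular_space X" shows "regular_space (vietoris X)"
proof -
  have "\<exists>\<W> \<C>. openin (vietoris X) \<W> \<and> closedin (vietoris X) \<C> \<and> K \<in> \<W> \<and> \<W> \<subseteq> \<C> \<and> \<C> \<subseteq> \<O>"
    if "openin (vietoris X) \<O>" "K \<in> \<O>" for \<O> K
  proof -
    from that obtain \<U> where U: "finite \<U>" "\<U> \<noteq> {}" "\<forall>U\<in>\<U>. openin X U"
        "K \<in> vietoris_basic X \<U>" "vietoris_basic X \<U> \<subseteq> \<O>"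
      by (rule vietoris_nhd)
    obtain \<W> C D where W: "openin (vietoris X) \<W>" "K \<in> \<W>" "closedin X C" "C \<subseteq> \<Union>\<U>"
      "\<And>U. U \<in> \<U> \<Longrightarrow> closedin X (D U) \<and> D U \<subseteq> U"
      "\<And>L. L \<in> \<W> \<Longrightarrow> L \<subseteq> C \<and> (\<forall>U\<in>\<U>. L \<inter> D U \<noteq> {})"
      using vietoris_closed_nhd[OF assms U(1) U(3)[rule_format] U(4)] by metis
    let ?\<C> = "{L \<in> topspace (vietoris X). L \<subseteq> C \<and> (\<forall>U\<in>\<U>. L \<inter> D U \<noteq> {})}"
    have "closedin (vietoris X) ?\<C>" using W(3,5) by (intro closedin_vietoris_subset_hits) auto
    moreover have "\<W> \<subseteq> ?\<C>" using W(6) openin_subset[OF W(1)] by blast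
    moreover have "?\<C> \<subseteq> vietoris_basic X \<U>"
    proof
      fix L assume L: "L \<in> ?\<C>"
      then have "L \<inter> U \<noteq> {}" if "U \<in> \<U>" for U using W(5)[OF that] that by blast
      then show "L \<in> vietoris_basic X \<U>" using L W(4) by (auto simp: vietoris_basic_def topspace_vietoris)
    qed
    ultimately show ?thesis using W(1,2) U(5) by (meson order_trans)
  qed
  then have "neighbourhood_base_of (closedin (vietoris X)) (vietoris X)"
    unfolding neighbourhood_base_of by (intro allI impI) (elim conjE)
  then show ?thesis by (simp add: neighbourhood_base_of_closedin)
qed

text \<open>The neighbourhood must contain \<open>K\<close> and omit \<open>L\<close>. A point of
  \<open>K\<close> outside \<open>L\<close> is used by hitting the complement of \<open>L\<close>,
  closed because \<open>X\<close> is Hausdorff; a point of \<open>L\<close> outside \<open>K\<close>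
  is used by avoiding it.\<close>

lemma t1_space_vietoris:
  assumes "Hausdorff_space X" shows "t1_space (vietoris X)"
  unfolding t1_space_def
proof (intro ballI impI)
  fix K L assume K: "K \<in> topspace (vietoris X)" and L: "L \<in> topspace (vietoris X)" and "K \<noteq> L"
  then consider x where "x \<in> K" "x \<notin> L" | x where "x \<in> L" "x \<notin> K" by blast
  then show "\<exists>\<U>. openin (vietoris X) \<U> \<and> K \<in> \<U> \<and> L \<notin> \<U>"
  proof cases
    case 1
    have "closedin X L" using L assms by (simp add: topspace_vietoris compactin_imp_closedin)
    then have "openin X (topspace X - L)" by (simp add: closedin_def)
    then have "openin (vietoris X) {M \<in> topspace (vietoris X). M \<inter> (topspace X - L) \<noteq> {}}"
      by (rule openin_vietoris_hit)
    moreover have "x \<in> topspace X" using K 1 compactin_subset_topspace by (auto simp: topspace_vietoris)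
    ultimately show ?thesis using K 1
      by (intro exI[of _ "{M \<in> topspace (vietoris X). M \<inter> (topspace X - L) \<noteq> {}}"]) auto
  next
    case 2
    have "x \<in> topspace X" using L 2 compactin_subset_topspace by (auto simp: topspace_vietoris)
    then have "closedin X {x}" using assms Hausdorff_imp_t1_space closedin_t1_singleton by metis
    then have "openin X (topspace X - {x})" by (simp add: closedin_def)
    then have "openin (vietoris X) {M \<in> topspace (vietoris X). M \<subseteq> topspace X - {x}}"
      by (rule openin_vietoris_subset)
    moreover have "K \<subseteq> topspace X - {x}" using K 2 compactin_subset_topspace by (auto simp: topspace_vietoris)
    ultimately show ?thesis using K 2
      by (intro exI[of _ "{M \<in> topspace (vietoris X). M \<subseteq> topspace X - {x}}"]) auto
  qed
qed

section \<open>The doubleton map into the symmetric square\<close>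

lemma continuous_map_doubleton:
  "continuous_map (prod_topology X X) (vietoris X) (\<lambda>(x, y). {x, y})"
  unfolding vietoris_def
proof (rule continuous_on_generated_topo)
  let ?f = "\<lambda>(x, y). {x, y}" and ?T = "topspace (prod_topology X X)"
  fix \<O> assume "\<O> \<in> {vietoris_basic X \<U> | \<U>. finite \<U> \<and> \<U> \<noteq> {} \<and> (\<forall>U\<in>\<U>. openin X U)}"
  then obtain \<U> where U: "\<O> = vietoris_basic X \<U>" "finite \<U>" "\<U> \<noteq> {}" "\<And>U. U \<in> \<U> \<Longrightarrow> openin X U"
    by auto
  let ?\<N> = "(\<lambda>U. U \<times> topspace X \<union> topspace X \<times> U) ` \<U>"
  have "openin (prod_topology X X) (\<Union>\<U> \<times> \<Union>\<U>)"
    using U(4) by (simp add: openin_prod_Times_iff openin_Union)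
  moreover have "openin (prod_topology X X) (\<Inter>?\<N>)"
    by (rule openin_Inter) (use U in \<open>auto intro!: openin_Un simp: openin_prod_Times_iff\<close>)
  moreover have "p \<in> ?f -` \<O> \<inter> ?T \<longleftrightarrow> p \<in> (\<Union>\<U> \<times> \<Union>\<U>) \<inter> \<Inter>?\<N>" for p
  proof (cases p)
    case (Pair x y)
    show ?thesis
    proof (cases "x \<in> topspace X \<and> y \<in> topspace X")
      case True
      then have "compactin X {x, y}" by (simp add: finite_imp_compactin)
      moreover have "{x, y} \<inter> U \<noteq> {} \<longleftrightarrow> x \<in> U \<or> y \<in> U" for U by auto
      ultimately show ?thesis
        using True U(3) by (auto simp: Pair U(1) vietoris_basic_def)
    next
      case False
      have "\<Union>\<U> \<subseteq> topspace X" using U(4) openin_subset by (meson Union_least)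
      then have "p \<notin> \<Union>\<U> \<times> \<Union>\<U>" using False Pair by blast
      moreover have "p \<notin> ?T" using False Pair by simp
      ultimately show ?thesis by (meson IntD1 IntD2)
    qed
  qed
  then have "?f -` \<O> \<inter> ?T = (\<Union>\<U> \<times> \<Union>\<U>) \<inter> \<Inter>?\<N>" by (rule set_eqI)
  ultimately show "openin (prod_topology X X) (?f -` \<O> \<inter> ?T)" using openin_Int by simp
next
  have "(\<lambda>(x, y). {x, y}) ` topspace (prod_topology X X) \<subseteq> topspace (vietoris X)"
    by (auto simp: topspace_vietoris finite_imp_compactin)
  then show "(\<lambda>(x, y). {x, y}) ` topspace (prod_topology X X)
      \<subseteq> \<Union>{vietoris_basic X \<U> | \<U>. finite \<U> \<and> \<U> \<noteq> {} \<and> (\<forall>U\<in>\<U>. openin X U)}"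
    unfolding vietoris_def by simp
qed

lemma topspace_fin2_hyperspace:
  "topspace (fin2_hyperspace X) = {F. finite F \<and> F \<noteq> {} \<and> card F \<le> 2 \<and> F \<subseteq> topspace X}"
  by (auto simp: fin2_hyperspace_def topspace_vietoris finite_imp_compactin)

lemma continuous_map_doubleton_fin2:
  "continuous_map (prod_topology X X) (fin2_hyperspace X) (\<lambda>(x, y). {x, y})"
  unfolding fin2_hyperspace_def continuous_map_in_subtopology
  using continuous_map_doubleton by (auto simp: card_insert_if)

lemma continuous_map_pair_fin2:
  assumes "z \<in> topspace X"
  shows "continuous_map X (fin2_hyperspace X) (\<lambda>y. {z, y})"
proof -
  have "continuous_map X (prod_topology X X) (\<lambda>y. (z, y))"
    using assms by (intro continuous_map_pairedI) simp_all
  from continuous_map_compose[OF this continuous_map_doubleton_fin2] show ?thesis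
    by (simp add: o_def)
qed

lemma openin_fin2_subset:
  assumes "openin X U" shows "openin (fin2_hyperspace X) {F \<in> topspace (fin2_hyperspace X). F \<subseteq> U}"
proof -
  have "{F \<in> topspace (fin2_hyperspace X). F \<subseteq> U} = {K \<in> topspace (vietoris X). K \<subseteq> U} \<inter>
      {F. finite F \<and> F \<noteq> {} \<and> card F \<le> 2 \<and> F \<subseteq> topspace X}"
    by (auto simp: fin2_hyperspace_def)
  then show ?thesis
    using openin_vietoris_subset[OF assms] by (auto simp: fin2_hyperspace_def openin_subtopology)
qed

lemma initial_map_singleton: "initial_map X (fin2_hyperspace X) (\<lambda>x. {x})"
  unfolding initial_map_def
proof (intro conjI allI impI)
  have "continuous_map X (prod_topology X X) (\<lambda>y. (y, y))"
    by (intro continuous_map_pairedI) simp_all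
  from continuous_map_compose[OF this continuous_map_doubleton_fin2]
  show "continuous_map X (fin2_hyperspace X) (\<lambda>x. {x})" by (simp add: o_def)
  fix U assume U: "openin X U"
  show "\<exists>V. openin (fin2_hyperspace X) V \<and> U = {x \<in> topspace X. {x} \<in> V}"
    using openin_fin2_subset[OF U] openin_subset[OF U]
    by (intro exI[of _ "{F \<in> topspace (fin2_hyperspace X). F \<subseteq> U}"])
      (auto simp: topspace_fin2_hyperspace)
qed

section \<open>Hyperspaces of compact sets\<close>

text \<open>A finite subcover for \<open>K\<close> also covers every nearby compact set, since the
  compact sets inside its union form an open set; finitely many such open sets cover
  \<open>\<K>\<close>.\<close>

lemma compactin_Union_vietoris:
  assumes \<K>: "compactin (vietoris X) \<K>"
  shows "compactin X (\<Union>\<K>)"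
  unfolding compactin_def
proof (intro conjI allI impI)
  have cK: "compactin X K" if "K \<in> \<K>" for K
    using compactin_subset_topspace[OF \<K>] that by (auto simp: topspace_vietoris)
  then show "\<Union>\<K> \<subseteq> topspace X" using compactin_subset_topspace by (meson Union_least)
  fix \<U> assume U: "(\<forall>U\<in>\<U>. openin X U) \<and> \<Union>\<K> \<subseteq> \<Union>\<U>"
  have "\<exists>\<F>. finite \<F> \<and> \<F> \<subseteq> \<U> \<and> K \<subseteq> \<Union>\<F>" if "K \<in> \<K>" for K
  proof -
    have "K \<subseteq> \<Union>\<U>" using that U by blast
    then show ?thesis using cK[OF that] U by (simp add: compactin_def)
  qed
  then obtain \<F> where F: "\<And>K. K \<in> \<K> \<Longrightarrow> finite (\<F> K) \<and> \<F> K \<subseteq> \<U> \<and> K \<subseteq> \<Union>(\<F> K)" by metis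
  define N where "N K = {L \<in> topspace (vietoris X). L \<subseteq> \<Union>(\<F> K)}" for K
  have "openin (vietoris X) (N K)" if "K \<in> \<K>" for K
    unfolding N_def by (intro openin_vietoris_subset openin_Union) (use F[OF that] U in \<open>meson subsetD\<close>)
  then have "\<forall>V\<in>N ` \<K>. openin (vietoris X) V" by simp
  moreover have "K \<in> N K" if "K \<in> \<K>" for K
    using F[OF that] compactin_subset_topspace[OF \<K>] that by (auto simp: N_def)
  then have "\<K> \<subseteq> \<Union>(N ` \<K>)" by blast
  ultimately obtain \<G> where G: "finite \<G>" "\<G> \<subseteq> N ` \<K>" "\<K> \<subseteq> \<Union>\<G>"
    using \<K> unfolding compactin_def by meson
  obtain \<L> where L: "\<L> \<subseteq> \<K>" "finite \<L>" "\<G> = N ` \<L>" using finite_subset_image[OF G(1,2)] by metis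
  show "\<exists>\<F>. finite \<F> \<and> \<F> \<subseteq> \<U> \<and> \<Union>\<K> \<subseteq> \<Union>\<F>"
  proof (intro exI conjI)
    show "finite (\<Union>K\<in>\<L>. \<F> K)" "(\<Union>K\<in>\<L>. \<F> K) \<subseteq> \<U>" using L(1,2) F by (auto intro!: finite_UN_I)
    show "\<Union>\<K> \<subseteq> \<Union>(\<Union>K\<in>\<L>. \<F> K)"
    proof (rule Union_least)
      fix M assume "M \<in> \<K>"
      then obtain K where "K \<in> \<L>" "M \<in> N K" using G(3) L(3) by blast
      moreover from this have "M \<subseteq> \<Union>(\<F> K)" by (simp add: N_def)
      ultimately show "M \<subseteq> \<Union>(\<Union>K\<in>\<L>. \<F> K)" by blast
    qed
  qed
qed

text \<open>The k-network consists of the sets \<open>vietoris_basic X \<A>\<close> for finite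
  subfamilies \<open>\<A>\<close> of the k-network of \<open>X\<close>, whose members need not be
  open. If such a set contains some \<open>L \<subseteq> V\<close>, every member of
  \<open>\<A>\<close> meets \<open>V\<close>; for suitable \<open>V \<supseteq> K\<close> this
  leaves finitely many \<open>\<A>\<close> at each level.\<close>

theorem aleph_space_vietoris:
  assumes X: "regular_space X" and "aleph_space X"
  shows "aleph_space (vietoris X)"
proof -
  obtain \<P>0 where P0: "k_network X (\<Union>n::nat. \<P>0 n)" "\<And>n. locally_finite_in X (\<P>0 n)"
    using assms(2) unfolding aleph_space_def sigma_locally_finite_def by blast
  define \<P> where "\<P> n = (\<Union>i\<le>n. \<P>0 i)" for n
  have P_mono: "\<P> m \<subseteq> \<P> n" if "m \<le> n" for m n
    unfolding \<P>_def using that by (intro UN_mono) auto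
  have P0_P: "(\<Union>n. \<P>0 n) \<subseteq> (\<Union>n. \<P> n)" by (auto simp: \<P>_def)
  have P_lf: "\<exists>V. openin X V \<and> K \<subseteq> V \<and> finite {P \<in> \<P> n. P \<inter> V \<noteq> {}}" if K: "compactin X K" for n K
  proof -
    have "\<exists>V. openin X V \<and> x \<in> V \<and> finite {P \<in> \<P> n. P \<inter> V \<noteq> {}}" if "x \<in> topspace X" for x
    proof -
      have "\<exists>V. openin X V \<and> x \<in> V \<and> finite {P \<in> \<P>0 i. P \<inter> V \<noteq> {}}" for i
        using P0(2)[of i] that by (simp add: locally_finite_in_def)
      then have "\<forall>i. \<exists>V. openin X V \<and> x \<in> V \<and> finite {P \<in> \<P>0 i. P \<inter> V \<noteq> {}}" by (rule allI)
      then obtain V where V: "\<forall>i. openin X (V i) \<and> x \<in> V i \<and> finite {P \<in> \<P>0 i. P \<inter> V i \<noteq> {}}"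
        by (rule choice[THEN exE])
      have "openin X (\<Inter>i\<in>{..n}. V i)" using V by (intro openin_INT2) auto
      moreover have "{P \<in> \<P> n. P \<inter> (\<Inter>i\<in>{..n}. V i) \<noteq> {}} \<subseteq> (\<Union>i\<le>n. {P \<in> \<P>0 i. P \<inter> V i \<noteq> {}})"
        by (auto simp: \<P>_def)
      moreover have "finite (\<Union>i\<le>n. {P \<in> \<P>0 i. P \<inter> V i \<noteq> {}})" using V by (intro finite_UN_I) auto
      ultimately show ?thesis using V by (intro exI[of _ "\<Inter>i\<in>{..n}. V i"]) (simp add: finite_subset)
    qed
    then have "\<forall>x\<in>K. \<exists>V. openin X V \<and> x \<in> V \<and> finite {P \<in> \<P> n. P \<inter> V \<noteq> {}}"
      using compactin_subset_topspace[OF K] by (simp add: subset_iff)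
    then obtain V where V: "\<forall>x\<in>K. openin X (V x) \<and> x \<in> V x \<and> finite {P \<in> \<P> n. P \<inter> V x \<noteq> {}}"
      by (rule bchoice[THEN exE])
    have "\<forall>U\<in>V ` K. openin X U" "K \<subseteq> \<Union>(V ` K)" using V by auto
    then obtain \<F> where F: "finite \<F>" "\<F> \<subseteq> V ` K" "K \<subseteq> \<Union>\<F>"
      using K unfolding compactin_def by meson
    have "openin X (\<Union>\<F>)" by (rule openin_Union) (use F(2) V in blast)
    moreover have "finite (\<Union>U\<in>\<F>. {P \<in> \<P> n. P \<inter> U \<noteq> {}})" using F V by (intro finite_UN_I) auto
    moreover have "{P \<in> \<P> n. P \<inter> \<Union>\<F> \<noteq> {}} \<subseteq> (\<Union>U\<in>\<F>. {P \<in> \<P> n. P \<inter> U \<noteq> {}})" by blast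
    ultimately show ?thesis using F(3) by (intro exI[of _ "\<Union>\<F>"]) (simp add: finite_subset)
  qed
  define \<B> where "\<B> n = vietoris_basic X ` {\<A>. finite \<A> \<and> \<A> \<subseteq> \<P> n}" for n
  have "locally_finite_in (vietoris X) (\<B> n)" for n
    unfolding locally_finite_in_def
  proof (intro conjI ballI)
    show "\<Union>(\<B> n) \<subseteq> topspace (vietoris X)" by (auto simp: \<B>_def vietoris_basic_def topspace_vietoris)
    fix K assume K: "K \<in> topspace (vietoris X)"
    then obtain V where V: "openin X V" "K \<subseteq> V" "finite {P \<in> \<P> n. P \<inter> V \<noteq> {}}"
      using P_lf[of K n] by (auto simp: topspace_vietoris)
    let ?N = "{L \<in> topspace (vietoris X). L \<subseteq> V}"
    have "{B \<in> \<B> n. B \<inter> ?N \<noteq> {}} \<subseteq> vietoris_basic X ` Pow {P \<in> \<P> n. P \<inter> V \<noteq> {}}"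
    proof clarify
      fix B assume B: "B \<in> \<B> n" "B \<inter> ?N \<noteq> {}"
      then obtain \<A> L where A: "\<A> \<subseteq> \<P> n" "B = vietoris_basic X \<A>" "L \<in> vietoris_basic X \<A>" "L \<subseteq> V"
        by (auto simp: \<B>_def)
      have "P \<inter> V \<noteq> {}" if "P \<in> \<A>" for P
      proof -
        have "L \<inter> P \<noteq> {}" using A(3) that by (simp add: vietoris_basic_def)
        then show ?thesis using A(4) by blast
      qed
      then have "\<A> \<in> Pow {P \<in> \<P> n. P \<inter> V \<noteq> {}}" using A(1) by blast
      then show "B \<in> vietoris_basic X ` Pow {P \<in> \<P> n. P \<inter> V \<noteq> {}}" using A(2) by simp
    qed
    then have "finite {B \<in> \<B> n. B \<inter> ?N \<noteq> {}}" by (rule finite_subset) (use V(3) in simp)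
    then show "\<exists>\<V>. openin (vietoris X) \<V> \<and> K \<in> \<V> \<and> finite {B \<in> \<B> n. B \<inter> \<V> \<noteq> {}}"
      using openin_vietoris_subset[OF V(1)] K V(2) by (intro exI[of _ ?N]) simp
  qed
  then have "sigma_locally_finite (vietoris X) (\<Union>n. \<B> n)"
    unfolding sigma_locally_finite_def by (intro exI[of _ \<B>]) simp
  moreover have "k_network (vietoris X) (\<Union>n. \<B> n)"
    unfolding k_network_def
  proof (intro conjI allI impI ballI)
    show "B \<subseteq> topspace (vietoris X)" if "B \<in> (\<Union>n. \<B> n)" for B
      using that by (auto simp: \<B>_def vietoris_basic_def topspace_vietoris)
    fix \<K> \<O> assume KO: "compactin (vietoris X) \<K> \<and> openin (vietoris X) \<O> \<and> \<K> \<subseteq> \<O>"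
    have loc: "\<exists>\<W> \<D>. openin (vietoris X) \<W> \<and> K \<in> \<W> \<and> finite \<D> \<and> \<D> \<subseteq> (\<Union>n. \<B> n) \<and> \<K> \<inter> \<W> \<subseteq> \<Union>\<D> \<and> \<Union>\<D> \<subseteq> \<O>"
      if K: "K \<in> \<K>" for K
    proof -
      have "openin (vietoris X) \<O>" "K \<in> \<O>" using KO K by blast+
      then obtain \<U> where U: "finite \<U>" "\<U> \<noteq> {}" "\<forall>U\<in>\<U>. openin X U"
          "K \<in> vietoris_basic X \<U>" "vietoris_basic X \<U> \<subseteq> \<O>"
        by (rule vietoris_nhd)
      obtain \<W> C D where W: "openin (vietoris X) \<W>" "K \<in> \<W>" "closedin X C" "C \<subseteq> \<Union>\<U>"
        "\<And>U. U \<in> \<U> \<Longrightarrow> closedin X (D U) \<and> D U \<subseteq> U"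
        "\<And>L. L \<in> \<W> \<Longrightarrow> L \<subseteq> C \<and> (\<forall>U\<in>\<U>. L \<inter> D U \<noteq> {})"
        using vietoris_closed_nhd[OF X U(1) U(3)[rule_format] U(4)] by metis
      have M: "compactin X (\<Union>\<K>)" using KO by (simp add: compactin_Union_vietoris)
      have net: "\<exists>\<Q>. finite \<Q> \<and> \<Q> \<subseteq> (\<Union>n. \<P>0 n) \<and> \<Union>\<K> \<inter> A \<subseteq> \<Union>\<Q> \<and> \<Union>\<Q> \<subseteq> V"
        if "closedin X A" "A \<subseteq> V" "openin X V" for A V
      proof -
        have "compactin X (\<Union>\<K> \<inter> A)" using M that(1) by (rule compact_Int_closedin)
        moreover have "\<Union>\<K> \<inter> A \<subseteq> V" using that(2) by blast
        ultimately show ?thesis using P0(1) that(3) unfolding k_network_def by metis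
      qed
      have "openin X (\<Union>\<U>)" using U(3) by (simp add: openin_Union)
      then obtain \<Q>0 where Q0: "finite \<Q>0" "\<Q>0 \<subseteq> (\<Union>n. \<P>0 n)" "\<Union>\<K> \<inter> C \<subseteq> \<Union>\<Q>0" "\<Union>\<Q>0 \<subseteq> \<Union>\<U>"
        using net[OF W(3,4)] by metis
      have "\<exists>\<Q>. finite \<Q> \<and> \<Q> \<subseteq> (\<Union>n. \<P>0 n) \<and> \<Union>\<K> \<inter> D U \<subseteq> \<Union>\<Q> \<and> \<Union>\<Q> \<subseteq> U" if "U \<in> \<U>" for U
        using W(5)[OF that] bspec[OF U(3) that] by (intro net) auto
      then obtain \<Q> where Q: "\<And>U. U \<in> \<U> \<Longrightarrow> finite (\<Q> U) \<and> \<Q> U \<subseteq> (\<Union>n. \<P>0 n) \<and> \<Union>\<K> \<inter> D U \<subseteq> \<Union>(\<Q> U) \<and> \<Union>(\<Q> U) \<subseteq> U"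
        by metis
      \<comment> \<open>\<open>\<Q>0\<close> controls containment in \<open>\<Union>\<U>\<close>,
        and \<open>\<Q> U\<close> controls hitting \<open>U\<close>.\<close>
      let ?R = "\<Q>0 \<union> (\<Union>U\<in>\<U>. \<Q> U)"
      have R: "finite ?R" using Q0(1) U(1) Q by simp
      have "(\<Union>U\<in>\<U>. \<Q> U) \<subseteq> (\<Union>n. \<P>0 n)" using Q by (intro UN_least) simp
      with Q0(2) have "?R \<subseteq> (\<Union>n. \<P>0 n)" by (rule Un_least)
      then have "?R \<subseteq> (\<Union>n. \<P> n)" using P0_P by (rule order_trans)
      then obtain n where n: "?R \<subseteq> \<P> n"
        by (rule finite_subset_incseq_UN[OF R _ P_mono]) (assumption | rule that)+
      have "\<Union>(\<Q> U) \<subseteq> \<Union>\<U>" if "U \<in> \<U>" for U using Q[OF that] that by (meson Union_upper order_trans)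
      then have RU: "\<Union>?R \<subseteq> \<Union>\<U>" using Q0(4) by (simp add: Union_Un_distrib Union_least UN_least Sup_le_iff)
      let ?\<D> = "{vietoris_basic X \<A> | \<A>. \<A> \<subseteq> ?R \<and> vietoris_basic X \<A> \<subseteq> \<O>}"
      have "?\<D> \<subseteq> vietoris_basic X ` Pow ?R" by blast
      then have "finite ?\<D>" by (rule finite_subset) (use R in simp)
      moreover have "?\<D> \<subseteq> \<B> n"
      proof clarify
        fix \<A> assume A: "\<A> \<subseteq> ?R" 
        have "finite \<A>" "\<A> \<subseteq> \<P> n" using finite_subset[OF A R] order_trans[OF A n] by auto
        then show "vietoris_basic X \<A> \<in> \<B> n" by (simp add: \<B>_def)
      qed
      then have "?\<D> \<subseteq> (\<Union>n. \<B> n)" by (meson UNIV_I UN_upper order_trans)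
      moreover have "\<Union>?\<D> \<subseteq> \<O>" by blast
      moreover have "\<K> \<inter> \<W> \<subseteq> \<Union>?\<D>"
      proof
        fix L assume L: "L \<in> \<K> \<inter> \<W>"
        \<comment> \<open>\<open>L\<close> selects the members of \<open>?R\<close> that it meets.
          They cover \<open>L\<close> through \<open>\<Q>0\<close>; and as \<open>L\<close> meets
          \<open>D U\<close>, some selected member lies in \<open>U\<close>, so that every set
          hitting the selected members hits \<open>U\<close>.\<close>
        define \<A> where "\<A> = {A \<in> ?R. A \<inter> L \<noteq> {}}"
        have LC: "L \<subseteq> \<Union>\<Q>0" using L W(6)[of L] Q0(3) by blast
        have cL: "compactin X L" "L \<noteq> {}"
          using L KO compactin_subset_topspace[of "vietoris X" \<K>] by (auto simp: topspace_vietoris)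
        have "L \<in> vietoris_basic X \<A>"
          using LC cL by (fastforce simp: vietoris_basic_def \<A>_def)
        moreover have "vietoris_basic X \<A> \<subseteq> vietoris_basic X \<U>"
        proof
          fix M assume M: "M \<in> vietoris_basic X \<A>"
          have "M \<subseteq> \<Union>\<A>" using M by (simp add: vietoris_basic_def)
          moreover have "\<Union>\<A> \<subseteq> \<Union>?R" unfolding \<A>_def by (rule Union_mono) (rule Collect_restrict)
          ultimately have "M \<subseteq> \<Union>\<U>" using RU by (meson order_trans)
          moreover have "M \<inter> U \<noteq> {}" if u: "U \<in> \<U>" for U
          proof -
            obtain z where z: "z \<in> L" "z \<in> D U" using L W(6)[of L] u by blast
            then have "z \<in> \<Union>(\<Q> U)" using Q[OF u] L by blast
            then obtain A where A: "A \<in> \<Q> U" "z \<in> A" by blast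
            then have "A \<in> \<A>" using z(1) u by (auto simp: \<A>_def)
            then have "M \<inter> A \<noteq> {}" using M by (auto simp: vietoris_basic_def)
            moreover have "A \<subseteq> U" using Q[OF u] A(1) by blast
            ultimately show ?thesis by blast
          qed
          ultimately show "M \<in> vietoris_basic X \<U>" using M by (auto simp: vietoris_basic_def)
        qed
        moreover have "\<A> \<subseteq> ?R" by (auto simp: \<A>_def)
        ultimately show "L \<in> \<Union>?\<D>" using U(5) by blast
      qed
      ultimately show ?thesis using W(1,2) by (intro exI[of _ \<W>] exI[of _ ?\<D>]) simp
    qed
    then obtain \<W> \<D> where WD: "\<And>K. K \<in> \<K> \<Longrightarrow> openin (vietoris X) (\<W> K) \<and> K \<in> \<W> K \<and> finite (\<D> K) \<and>
        \<D> K \<subseteq> (\<Union>n. \<B> n) \<and> \<K> \<inter> \<W> K \<subseteq> \<Union>(\<D> K) \<and> \<Union>(\<D> K) \<subseteq> \<O>"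
      by metis
    have "\<forall>U\<in>\<W> ` \<K>. openin (vietoris X) U" "\<K> \<subseteq> \<Union>(\<W> ` \<K>)" using WD by auto
    then obtain \<G> where G: "finite \<G>" "\<G> \<subseteq> \<W> ` \<K>" "\<K> \<subseteq> \<Union>\<G>"
      using KO unfolding compactin_def by meson
    obtain \<L> where L: "\<L> \<subseteq> \<K>" "finite \<L>" "\<G> = \<W> ` \<L>" using finite_subset_image[OF G(1,2)] by metis
    have WL: "finite (\<D> K)" "\<D> K \<subseteq> (\<Union>n. \<B> n)" "\<K> \<inter> \<W> K \<subseteq> \<Union>(\<D> K)" "\<Union>(\<D> K) \<subseteq> \<O>" if "K \<in> \<L>" for K
      using WD[of K] that L(1) by auto
    show "\<exists>\<P>'\<subseteq>(\<Union>n. \<B> n). finite \<P>' \<and> \<K> \<subseteq> \<Union>\<P>' \<and> \<Union>\<P>' \<subseteq> \<O>"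
    proof (intro exI conjI)
      show "(\<Union>K\<in>\<L>. \<D> K) \<subseteq> (\<Union>n. \<B> n)" using WL(2) by (rule UN_least)
      show "finite (\<Union>K\<in>\<L>. \<D> K)" using L(2) WL(1) by (rule finite_UN_I)
      show "\<K> \<subseteq> \<Union>(\<Union>K\<in>\<L>. \<D> K)"
      proof
        fix M assume M: "M \<in> \<K>"
        then obtain K where "K \<in> \<L>" "M \<in> \<W> K" using G(3) L(3) by blast
        then show "M \<in> \<Union>(\<Union>K\<in>\<L>. \<D> K)" using WL(3)[of K] M by blast
      qed
      show "\<Union>(\<Union>K\<in>\<L>. \<D> K) \<subseteq> \<O>" using WL(4) by (meson UN_E Union_least Union_upper order_trans)
    qed
  qed
  ultimately show ?thesis unfolding aleph_space_def by metis
qed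

section \<open>Countable local k-networks from the symmetric square\<close>

lemma regular_space_fin2:
  "regular_space X \<Longrightarrow> regular_space (fin2_hyperspace X)"
  unfolding fin2_hyperspace_def by (intro regular_space_subtopology regular_space_vietoris)

lemma t1_space_fin2:
  "Hausdorff_space X \<Longrightarrow> t1_space (fin2_hyperspace X)"
  unfolding fin2_hyperspace_def by (intro t1_space_subtopology t1_space_vietoris)

text \<open>The complement of \<open>x\<close> is a union of closed sets \<open>F m\<close>. By
  regularity there are decreasing open \<open>W m\<close> around \<open>x\<close> whose closures
  avoid \<open>F m\<close>, hence have only \<open>x\<close> in common, and compactness turns them
  into a neighbourhood base of \<open>x\<close> along \<open>L\<close>.\<close>

lemma (in closed_hcp_k_network) limit_sequence_in_compact:
  assumes L: "compactin X L" and x: "x \<in> topspace X"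
    and limit: "\<And>V. openin X V \<Longrightarrow> x \<in> V \<Longrightarrow> \<exists>z\<in>L \<inter> V. z \<noteq> x"
  obtains z :: "nat \<Rightarrow> 'a" where "\<And>i. z i \<in> L" "\<And>i. z i \<noteq> x"
    "\<And>V. openin X V \<Longrightarrow> x \<in> V \<Longrightarrow> \<exists>i. z i \<in> V"
proof -
  define F where "F m = exhaustion (topspace X - {x}) m" for m
  have F: "closedin X (F m)" "x \<notin> F m" for m
    using closedin_exhaustion exhaustion_subset[of "topspace X - {x}" m] by (auto simp: F_def)
  have "\<exists>G. openin X G \<and> x \<in> G \<and> X closure_of G \<subseteq> topspace X - F m" for m
  proof -
    have "openin X (topspace X - F m)" using F(1) by (intro openin_diff openin_topspace)
    then obtain G where "openin X G" "x \<in> G" "X closure_of G \<subseteq> topspace X - F m"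
      by (rule regular_space_nhd[OF regular]) (use x F(2) in auto)
    then show ?thesis by (intro exI[of _ G]) simp
  qed
  then have "\<forall>m. \<exists>G. openin X G \<and> x \<in> G \<and> X closure_of G \<subseteq> topspace X - F m" by (rule allI)
  then obtain G where G: "\<forall>m. openin X (G m) \<and> x \<in> G m \<and> X closure_of (G m) \<subseteq> topspace X - F m"
    by (rule choice[THEN exE])
  define W where "W m = (\<Inter>i\<in>{..m}. G i)" for m
  have W: "openin X (W m)" "x \<in> W m" for m
    unfolding W_def using G by (auto intro: openin_INT2)
  have W_mono: "W n \<subseteq> W m" if "m \<le> n" for m n
    unfolding W_def using that by (intro INT_anti_mono) auto
  have "\<forall>m. \<exists>z. z \<in> L \<inter> W m \<and> z \<noteq> x" using limit[OF W] by (metis)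
  then obtain z where z: "\<forall>m. z m \<in> L \<inter> W m \<and> z m \<noteq> x" by (rule choice[THEN exE])
  have "\<exists>i. z i \<in> V" if V: "openin X V" "x \<in> V" for V
  proof (rule ccontr)
    assume n: "\<nexists>i. z i \<in> V"
    \<comment> \<open>If all \<open>z i\<close> avoided \<open>V\<close>, the finite intersection
      property would give a point of \<open>L\<close> outside \<open>V\<close> in all these
      closures; it differs from \<open>x\<close> and so lies in some \<open>F m\<close>, a
      contradiction.\<close>
    let ?K = "\<lambda>m. L \<inter> (topspace X - V) \<inter> X closure_of (W m)"
    have "compactin X (L \<inter> (topspace X - V))"
      using L V(1) by (intro compact_Int_closedin closedin_diff closedin_topspace)
    moreover have "closedin X C" if "C \<in> range (\<lambda>m. X closure_of (W m))" for C
      using that by auto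
    moreover have "L \<inter> (topspace X - V) \<inter> \<Inter>\<F> \<noteq> {}"
      if \<F>: "finite \<F>" "\<F> \<subseteq> range (\<lambda>m. X closure_of (W m))" for \<F>
    proof -
      obtain M where M: "finite M" "\<F> = (\<lambda>m. X closure_of (W m)) ` M"
        using finite_subset_image[OF \<F>] by metis
      obtain k where k: "\<And>m. m \<in> M \<Longrightarrow> m \<le> k" using M(1) Max_ge by metis
      have "z k \<in> X closure_of (W m)" if "m \<in> M" for m
      proof -
        have "z k \<in> W m" using z W_mono[OF k[OF that]] by auto
        then show ?thesis using closure_of_subset[OF openin_subset[OF W(1)]] by auto
      qed
      moreover have "z k \<in> L \<inter> (topspace X - V)" using z n compactin_subset_topspace[OF L] by auto
      ultimately show ?thesis using M(2) by auto
    qed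
    ultimately have "L \<inter> (topspace X - V) \<inter> \<Inter>(range (\<lambda>m. X closure_of (W m))) \<noteq> {}"
      unfolding compactin_fip by metis
    then obtain y where y: "y \<in> L" "y \<in> topspace X" "y \<notin> V" "\<And>m. y \<in> X closure_of (W m)" by auto
    have "y \<notin> F m" for m
    proof -
      have "W m \<subseteq> G m" by (auto simp: W_def)
      then have "y \<in> X closure_of (G m)" using y(4)[of m] closure_of_mono by (metis subsetD)
      then show ?thesis using G by auto
    qed
    moreover have "compactin X {y}" "{y} \<subseteq> topspace X - {x}" using y V(2) by auto
    then obtain m where "{y} \<subseteq> F m"
      using compact_subset_exhaustion[OF _ openin_Diff_singleton[OF openin_topspace]] unfolding F_def by metis
    ultimately show False by simp
  qed
  then show thesis using z that by (metis IntD1)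
qed

text \<open>If \<open>L\<close> is compact and the \<open>z\<^sub>i \<in> L\<close> cluster at \<open>x\<close>, only countably many members of the k-network contain
  infinitely many of the points \<open>{z, x}\<close> with \<open>z \<in> L\<close>. Cover \<open>{{z, k} | z \<in> L, k \<in> K}\<close> by
  finitely many members; the other ones avoid \<open>{z\<^sub>i, x}\<close> for some \<open>i\<close>, so being closed they avoid
  \<open>{z\<^sub>i, k}\<close> for all \<open>k\<close> near \<open>x\<close>. Hence near \<open>x\<close> the set \<open>K\<close> is covered by the sections at \<open>z\<^sub>i\<close> of the
  countably many good members.\<close>
lemma countable_k_network_at_exists:
  assumes X: "regular_space X" "Hausdorff_space X"
    and netX: "closed_hcp_k_network X \<P>X"
    and netF: "closed_hcp_k_network (fin2_hyperspace X) \<P>"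
    and x: "x \<in> topspace X"
  shows "\<exists>C. countable_k_network_at X x C"
proof (cases "\<exists>L. compactin X L \<and> (\<forall>V. openin X V \<and> x \<in> V \<longrightarrow> (\<exists>z\<in>L \<inter> V. z \<noteq> x))")
  case False
  have "countable_k_network_at X x (\<lambda>i. {x})"
    unfolding countable_k_network_at_def
  proof (intro allI impI)
    fix K U assume K: "compactin X K \<and> x \<in> K \<and> openin X U \<and> x \<in> U"
    then obtain V where V: "openin X V" "x \<in> V" "\<not> (\<exists>z\<in>K \<inter> V. z \<noteq> x)" using False by metis
    then show "\<exists>(I :: nat set) V. finite I \<and> openin X V \<and> x \<in> V \<and> K \<inter> V \<subseteq> (\<Union>i\<in>I. {x}) \<and> (\<Union>i\<in>I. {x}) \<subseteq> U"
      using K by (intro exI[of _ "{0::nat}"] exI[of _ V]) auto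
  qed
  then show ?thesis by (rule exI[of _ "\<lambda>i. {x}"])
next
  case True
  let ?Y = "fin2_hyperspace X"
  interpret X: closed_hcp_k_network X \<P>X by (rule netX)
  interpret F: closed_hcp_k_network ?Y \<P> by (rule netF)
  obtain L where L: "compactin X L" "\<And>V. openin X V \<Longrightarrow> x \<in> V \<Longrightarrow> \<exists>z\<in>L \<inter> V. z \<noteq> x"
    using True by auto
  obtain z :: "nat \<Rightarrow> 'a" where z: "\<And>i. z i \<in> L" "\<And>i. z i \<noteq> x"
      "\<And>V. openin X V \<Longrightarrow> x \<in> V \<Longrightarrow> \<exists>i. z i \<in> V"
    using X.limit_sequence_in_compact[OF L(1) x L(2)] by metis
  have zX: "z i \<in> topspace X" for i using z(1) compactin_subset_topspace[OF L(1)] by auto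
  let ?T = "(\<lambda>w. {x, w}) ` L"
  have T: "compactin ?Y ?T" using L(1) continuous_map_pair_fin2[OF x] by (rule image_compactin)
  define \<G> where "\<G> = (\<Union>n. {P \<in> \<P> n. infinite (P \<inter> ?T)})"
  have "countable {P \<in> \<P> n. infinite (P \<inter> ?T)}" for n
    by (rule countable_finite) (rule finite_infinite_trace[OF F.t1 F.hcp T])
  then have "countable \<G>" unfolding \<G>_def by (intro countable_UN) auto
  \<comment> \<open>The empty set is added so that \<open>\<C>\<close> can be enumerated by the
    natural numbers even if \<open>\<G>\<close> is empty.\<close>
  define \<C> where "\<C> = insert {} ((\<lambda>(i, P). {y \<in> topspace X. {z i, y} \<in> P}) ` (UNIV \<times> \<G>))"
  have "countable \<C>" unfolding \<C>_def using \<open>countable \<G>\<close> by (intro countable_insert countable_image countable_SIGMA) auto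
  then obtain C :: "nat \<Rightarrow> 'a set" where C: "range C = \<C>"
    using range_from_nat_into[of \<C>] unfolding \<C>_def by (metis insert_not_empty)
  have "countable_k_network_at X x C"
    unfolding countable_k_network_at_def
  proof (intro allI impI)
    fix K U assume KU: "compactin X K \<and> x \<in> K \<and> openin X U \<and> x \<in> U"
    then obtain W where W: "openin X W" "x \<in> W" "X closure_of W \<subseteq> U"
      using regular_space_nhd[OF X(1)] by metis
    have WW: "W \<subseteq> X closure_of W" using openin_subset[OF W(1)] by (rule closure_of_subset)
    \<comment> \<open>Both factors are cut down, since a pair belongs to \<open>?U\<close> only if
      both its points lie in \<open>U\<close>.\<close>
    let ?L = "L \<inter> X closure_of W" and ?K = "K \<inter> X closure_of W"
    have "compactin X ?L" "compactin X ?K"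
      using L(1) KU by (auto intro!: compact_Int_closedin)
    then have "compactin (prod_topology X X) (?L \<times> ?K)" by (simp add: compactin_Times)
    then have cpt: "compactin ?Y ((\<lambda>(a, b). {a, b}) ` (?L \<times> ?K))"
      using continuous_map_doubleton_fin2 by (rule image_compactin)
    let ?U = "{F \<in> topspace ?Y. F \<subseteq> U}"
    have opU: "openin ?Y ?U" using KU openin_fin2_subset by auto
    have "(\<lambda>(a, b). {a, b}) ` (?L \<times> ?K) \<subseteq> ?U"
      using compactin_subset_topspace[OF cpt] W(3) by auto
    from F.network[OF cpt opU this] obtain n \<Q> where
      Q: "finite \<Q>" "\<Q> \<subseteq> \<P> n" "(\<lambda>(a, b). {a, b}) ` (?L \<times> ?K) \<subseteq> \<Union>\<Q>" "\<Union>\<Q> \<subseteq> ?U"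
      by (elim exE conjE) (rule that)
    define B where "B = (\<Union>P\<in>\<Q> - \<G>. {w \<in> L. {x, w} \<in> P})"
    have "finite {w \<in> L. {x, w} \<in> P}" if "P \<in> \<Q> - \<G>" for P
    proof -
      have "finite (P \<inter> ?T)" using that Q(2) by (auto simp: \<G>_def)
      moreover have "(\<lambda>w. {x, w}) ` {w \<in> L. {x, w} \<in> P} \<subseteq> P \<inter> ?T" by auto
      ultimately have "finite ((\<lambda>w. {x, w}) ` {w \<in> L. {x, w} \<in> P})" by (rule rev_finite_subset)
      moreover have "inj_on (\<lambda>w. {x, w}) {w \<in> L. {x, w} \<in> P}" by (auto simp: inj_on_def doubleton_eq_iff)
      ultimately show ?thesis by (rule finite_imageD)
    qed
    then have finB: "finite B" unfolding B_def using Q(1) by (intro finite_UN_I) auto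
    \<comment> \<open>\<open>B\<close> may contain \<open>x\<close>, so only \<open>B - {x}\<close>
      can be avoided by a neighbourhood of \<open>x\<close>; as \<open>z i \<noteq> x\<close>, this
      still gives \<open>z i \<notin> B\<close>, and every member through \<open>{z i, x}\<close>
      belongs to \<open>\<G>\<close>.\<close>
    have "B - {x} \<subseteq> topspace X" using compactin_subset_topspace[OF L(1)] by (auto simp: B_def)
    then have "closedin X (B - {x})" using finB X.t1 by (simp add: t1_space_closedin_finite)
    then have "openin X (W - (B - {x}))" using W(1) by (intro openin_diff)
    then obtain i where i: "z i \<in> W - (B - {x})" using z(3) W(2) by (metis DiffD2 DiffI insertI1)
    define \<H> where "\<H> = {P \<in> \<Q>. {z i, x} \<in> P}"
    have HG: "\<H> \<subseteq> \<G>"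
    proof
      fix P assume P: "P \<in> \<H>"
      show "P \<in> \<G>"
      proof (rule ccontr)
        assume "P \<notin> \<G>"
        then have "z i \<in> B" using P z(1) by (auto simp: B_def \<H>_def insert_commute)
        then show False using i z(2) by auto
      qed
    qed
    let ?S = "\<lambda>P. {y \<in> topspace X. {z i, y} \<in> P}"
    have SC: "?S P \<in> \<C>" if "P \<in> \<H>" for P
      unfolding \<C>_def by (rule insertI2, rule image_eqI[of _ _ "(i, P)"]) (use that HG in auto)
    have "\<forall>P\<in>\<H>. \<exists>k. C k = ?S P"
    proof
      fix P assume "P \<in> \<H>"
      then have "?S P \<in> range C" using SC C by simp
      then obtain k where "?S P = C k" by (rule rangeE)
      then show "\<exists>k. C k = ?S P" by (intro exI[of _ k]) (rule sym)
    qed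
    then obtain k where k: "\<forall>P\<in>\<H>. C (k P) = ?S P" by (rule bchoice[THEN exE])
    define V0 where "V0 = {y \<in> topspace X. {z i, y} \<in> topspace ?Y - \<Union>{P \<in> \<Q>. {z i, x} \<notin> P}}"
    have "openin ?Y (topspace ?Y - \<Union>{P \<in> \<Q>. {z i, x} \<notin> P})"
      using Q(2) F.closed by (intro openin_diff openin_topspace hcp_closedin_Union[OF F.hcp[of n]]) auto
    then have "openin X V0"
      unfolding V0_def by (rule openin_continuous_map_preimage[OF continuous_map_pair_fin2[OF zX]])
    then have "openin X (W \<inter> V0)" using W(1) by (intro openin_Int)
    moreover have "x \<in> V0" using x zX continuous_map_image_subset_topspace[OF continuous_map_pair_fin2[OF zX]]
      by (auto simp: V0_def)
    moreover have "K \<inter> (W \<inter> V0) \<subseteq> (\<Union>j\<in>k ` \<H>. C j)"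
    proof
      fix y assume y: "y \<in> K \<inter> (W \<inter> V0)"
      then have "(z i, y) \<in> ?L \<times> ?K" using WW i z(1) by auto
      then have "{z i, y} \<in> \<Union>\<Q>" using Q(3) by auto
      then obtain P where P: "P \<in> \<Q>" "{z i, y} \<in> P" by auto
      then have "P \<in> \<H>" using y by (auto simp: \<H>_def V0_def)
      moreover have "y \<in> C (k P)" using k \<open>P \<in> \<H>\<close> P(2) y by (auto simp: V0_def)
      ultimately show "y \<in> (\<Union>j\<in>k ` \<H>. C j)" by auto
    qed
    moreover have "(\<Union>j\<in>k ` \<H>. C j) \<subseteq> U"
    proof
      fix y assume "y \<in> (\<Union>j\<in>k ` \<H>. C j)"
      then obtain P where "P \<in> \<H>" "y \<in> C (k P)" by auto
      then have "P \<in> \<Q>" "{z i, y} \<in> P" using k by (auto simp: \<H>_def)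
      then have "{z i, y} \<in> ?U" using Q(4) by auto
      then show "y \<in> U" by simp
    qed
    moreover have "finite (k ` \<H>)" using Q(1) by (simp add: \<H>_def)
    ultimately show "\<exists>I V. finite I \<and> openin X V \<and> x \<in> V \<and> K \<inter> V \<subseteq> (\<Union>i\<in>I. C i) \<and> (\<Union>i\<in>I. C i) \<subseteq> U"
      using W(2) by (intro exI[of _ "k ` \<H>"] exI[of _ "W \<inter> V0"]) simp
  qed
  then show ?thesis by (rule exI[of _ C])
qed

theorem aleph_space_if_sigma_hcp_fin2:
  assumes X: "regular_space X" "Hausdorff_space X"
    and Y: "has_sigma_hcp_k_network (fin2_hyperspace X)"
  shows "aleph_space X"
proof -
  obtain \<P> where P: "closed_hcp_k_network (fin2_hyperspace X) \<P>"
    using closed_hcp_k_network_exists[OF regular_space_fin2[OF X(1)] t1_space_fin2[OF X(2)] Y] .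
  have "has_sigma_hcp_k_network X"
    using initial_map_singleton Y by (rule has_sigma_hcp_k_network_vimage)
  then obtain \<P>X where PX: "closed_hcp_k_network X \<P>X"
    using closed_hcp_k_network_exists[OF X(1) Hausdorff_imp_t1_space[OF X(2)]] by metis
  show ?thesis
    by (rule closed_hcp_k_network.aleph_space_if_locally_countable[OF PX])
      (rule countable_k_network_at_exists[OF X PX P])
qed

lemma initial_map_fin2_fin: "initial_map (fin2_hyperspace X) (fin_hyperspace X) id"
proof -
  have "fin2_hyperspace X = subtopology (fin_hyperspace X) {F. card F \<le> 2}"
    unfolding fin2_hyperspace_def fin_hyperspace_def subtopology_subtopology
    by (rule arg_cong[of _ _ "subtopology (vietoris X)"]) auto
  then show ?thesis by (simp add: initial_map_subtopology)
qed

theorem theorem3p7: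
  fixes X :: "'a topology"
  assumes "regular_space X" and "Hausdorff_space X"
  shows "(aleph_space X \<longleftrightarrow> has_sigma_hcp_k_network (fin2_hyperspace X)) \<and>
         (has_sigma_hcp_k_network (fin2_hyperspace X) \<longleftrightarrow> has_sigma_hcp_k_network (fin_hyperspace X)) \<and>
         (has_sigma_hcp_k_network (fin_hyperspace X) \<longleftrightarrow> aleph_space (fin_hyperspace X)) \<and>
         (aleph_space (fin_hyperspace X) \<longleftrightarrow> aleph_space (vietoris X))"
proof -
  have "aleph_space X \<Longrightarrow> aleph_space (vietoris X)"
    using assms(1) by (rule aleph_space_vietoris)
  moreover have "aleph_space (vietoris X) \<Longrightarrow> aleph_space (fin_hyperspace X)"
    unfolding fin_hyperspace_def by (rule aleph_space_vimage[OF initial_map_subtopology])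
  moreover have "aleph_space (fin_hyperspace X) \<Longrightarrow> has_sigma_hcp_k_network (fin_hyperspace X)"
    by (rule aleph_imp_sigma_hcp)
  moreover have "has_sigma_hcp_k_network (fin_hyperspace X) \<Longrightarrow> has_sigma_hcp_k_network (fin2_hyperspace X)"
    by (rule has_sigma_hcp_k_network_vimage[OF initial_map_fin2_fin])
  moreover have "has_sigma_hcp_k_network (fin2_hyperspace X) \<Longrightarrow> aleph_space X"
    using assms by (rule aleph_space_if_sigma_hcp_fin2)
  ultimately show ?thesis by argo
qed

end
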